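(* Let $M=\{1^{k_1},2^{k_2},\ldots,n^{k_n}\}$ be a multiset with all $k_i\ge 1$. For all integers $g,\ell\geq 1$ and $1\leq h\leq g+\ell$, we have $$\sum_{w\in\mathfrak{S}_M} t^{g\mathsf{des}_\ell(w)} q^{g\mathsf{maj}_\ell(w)}=\sum_{w\in \mathfrak{S}_M} t^{g\mathsf{exc}_\ell(w)} q^{g\mathsf{den}_h(w)}.$$
   Context: $i^{k_i}$ denotes $k_i$ occurrences of $i$; $m=k_1+\cdots+k_n$; $\mathfrak{S}_M$ is the set of all multipermutations (rearrangements, as words of length $m$) of $M$. Let $w=\alpha_1\alpha_2\ldots\alpha_m\in\mathfrak{S}_M$, and let $\bar w=x_1x_2\ldots x_m$ be its weakly increasing rearrangement. In the notations $g\mathsf{des}_\ell$, $g\mathsf{maj}_\ell$, $g\mathsf{exc}_\ell$, $g\mathsf{den}_h$, etc., the prefix $g$ and the subscript are integer parameters $\geq 1$ (not multiplication). For any word, $\mathsf{inv}$ is the number of pairs of positions $i<j$ whose letters satisfy (letter at $i$) $>$ (letter at $j$), and $\mathsf{imv}$ is the number of pairs $i<j$ with (letter at $i$) $\geq$ (letter at $j$). $g$-gap $\ell$-level descents: $g\mathsf{Des}_\ell(w)=\{i\in[m-1]\mid \alpha_i\geq\alpha_{i+1}+g,\ \alpha_{i+1}\geq\ell\}$ and $g\mathsf{des}_\ell(w)=|g\mathsf{Des}_\ell(w)|$. Let $g\mathsf{Inv}_\ell(w)=\{(i,j)\mid i<j,\ \alpha_i>\alpha_j,\ \text{and}\ (\alpha_j<\ell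 \text{ or } \alpha_i<\alpha_j+g)\}$. Then $g\mathsf{maj}_\ell(w)=\sum_{i\in g\mathsf{Des}_\ell(w)} i+|g\mathsf{Inv}_\ell(w)|$. $g$-gap $\ell$-level excedance number: $g\mathsf{exc}_\ell(w)=|\{i\in[m]\mid \alpha_i\geq x_i+g,\ x_i\geq\ell\}|$. $g$-gap $h$-level excedance places: $g\mathsf{Excp}_h(w)=\{i\in[m]\mid \alpha_i\geq x_i+g,\ \alpha_i\geq h\}$. Let $g\mathsf{Exc}_h(w)$ (resp. $g\mathsf{Nexc}_h(w)$) be the subword of $w$ formed by the letters at positions in (resp. not in) $g\mathsf{Excp}_h(w)$, in order. The $g$-gap $h$-level Denert's statistic is $$g\mathsf{den}_h(w)=\sum_{i\in g\mathsf{Excp}_h(w)}(i+B^g_i(w))+\mathsf{imv}(g\mathsf{Exc}_h(w))+\mathsf{inv}(g\mathsf{Nexc}_h(w)),\qquad B^g_i(w)=|\{j\mid \alpha_i-g<x_j<\alpha_i\}|.$$ *)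

theory Defs
  imports "HOL-Combinatorics.Multiset_Permutations" "HOL-Computational_Algebra.Polynomial"
begin

text \<open>
  Words are lists of natural numbers. As in the literature, positions in a word of length
  \<open>m\<close> are numbered \<open>1, \<dots>, m\<close>. This matters because positions themselves are summed in the
  major index and in Denert's statistic.
\<close>

definition letter :: "nat list \<Rightarrow> nat \<Rightarrow> nat" where
  "letter w i = w ! (i - 1)"

text \<open>The multiset \<open>{1^{k 1}, \<dots>, n^{k n}}\<close>.\<close>

definition word_mset :: "nat \<Rightarrow> (nat \<Rightarrow> nat) \<Rightarrow> nat multiset" where
  "word_mset n k = (\<Sum>i\<in>{1..n}. replicate_mset (k i) i)"

definition inv_num :: "nat list \<Rightarrow> nat" where
  "inv_num w = card {(i, j) \<in> {1..length w} \<times> {1..length w}. i < j \<and> letter w i > letter w j}"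

definition imv_num :: "nat list \<Rightarrow> nat" where
  "imv_num w = card {(i, j) \<in> {1..length w} \<times> {1..length w}. i < j \<and> letter w i \<ge> letter w j}"

definition gap_Des :: "nat \<Rightarrow> nat \<Rightarrow> nat list \<Rightarrow> nat set" where
  "gap_Des g l w =
     {i \<in> {1..<length w}. letter w i \<ge> letter w (i + 1) + g \<and> letter w (i + 1) \<ge> l}"

definition gap_des :: "nat \<Rightarrow> nat \<Rightarrow> nat list \<Rightarrow> nat" where
  "gap_des g l w = card (gap_Des g l w)"

definition gap_Inv :: "nat \<Rightarrow> nat \<Rightarrow> nat list \<Rightarrow> (nat \<times> nat) set" where
  "gap_Inv g l w =
     {(i, j) \<in> {1..length w} \<times> {1..length w}. i < j \<and> letter w i > letter w j \<and>
        (letter w j < l \<or> letter w i < letter w j + g)}"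

definition gap_maj :: "nat \<Rightarrow> nat \<Rightarrow> nat list \<Rightarrow> nat" where
  "gap_maj g l w = (\<Sum>i\<in>gap_Des g l w. i) + card (gap_Inv g l w)"

text \<open>Below, \<open>sort w\<close> is the weakly increasing rearrangement \<open>x\<^sub>1 \<dots> x\<^sub>m\<close> of \<open>w\<close>.\<close>

definition gap_exc :: "nat \<Rightarrow> nat \<Rightarrow> nat list \<Rightarrow> nat" where
  "gap_exc g l w =
     card {i \<in> {1..length w}. letter w i \<ge> letter (sort w) i + g \<and> letter (sort w) i \<ge> l}"

text \<open>Unlike in \<open>gap_exc\<close>, the level \<open>h\<close> here bounds the letter of \<open>w\<close>, not that of \<open>sort w\<close>.\<close>

definition gap_Excp :: "nat \<Rightarrow> nat \<Rightarrow> nat list \<Rightarrow> nat set" where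
  "gap_Excp g h w =
     {i \<in> {1..length w}. letter w i \<ge> letter (sort w) i + g \<and> letter w i \<ge> h}"

text \<open>\<open>nths\<close> numbers positions from 0, hence the \<open>Suc\<close>.\<close>

definition gap_Exc :: "nat \<Rightarrow> nat \<Rightarrow> nat list \<Rightarrow> nat list" where
  "gap_Exc g h w = nths w {i. Suc i \<in> gap_Excp g h w}"

definition gap_Nexc :: "nat \<Rightarrow> nat \<Rightarrow> nat list \<Rightarrow> nat list" where
  "gap_Nexc g h w = nths w {i. Suc i \<notin> gap_Excp g h w}"

text \<open>
  The condition \<open>\<alpha>\<^sub>i - g < x\<^sub>j\<close> is an inequality between integers. It is written
  without the truncating subtraction on natural numbers.
\<close>

definition gap_B :: "nat \<Rightarrow> nat list \<Rightarrow> nat \<Rightarrow> nat" where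
  "gap_B g w i =
     card {j \<in> {1..length w}. letter w i < letter (sort w) j + g \<and> letter (sort w) j < letter w i}"

definition gap_den :: "nat \<Rightarrow> nat \<Rightarrow> nat list \<Rightarrow> nat" where
  "gap_den g h w =
     (\<Sum>i\<in>gap_Excp g h w. i + gap_B g w i) + imv_num (gap_Exc g h w) + inv_num (gap_Nexc g h w)"

text \<open>
  The two indeterminates of \<open>\<int>[q][t]\<close>, so that the generating functions are compared as
  formal polynomials.
\<close>

definition var_t :: "int poly poly" where
  "var_t = [:0, 1:]"

definition var_q :: "int poly poly" where
  "var_q = [:[:0, 1:]:]"

end

theory Submission
  imports Defs
begin

text \<open>
  Both sides are shown to satisfy the same recursion under adding one more copy of the largest
  letter \<open>n\<close> to a multiset \<open>M\<close> of \<open>m\<close> letters. Write \<open>G t\<close> and \<open>G' t\<close> for the generating function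
  before and after, as functions of \<open>t\<close>, let \<open>k\<close> be the number of copies of \<open>n\<close> in \<open>M\<close>, and \<open>c\<close> the
  number of letters \<open>y\<close> of \<open>M\<close> with \<open>y < l\<close> or \<open>n < y + g\<close>. The recursion is
  \<open>(1 - q ^ (k + 1)) * G' t = (1 - t) * (G t - q ^ (c + 1) * G (t * q)) + t * (1 - q ^ (m + 1)) * G t\<close>.

  For descents and major index this is Carlitz insertion (\<open>sum_maj_weight_insert\<close>,
  \<open>maj_gf_add_max\<close>): inserting \<open>n\<close> into a word with \<open>s\<close> descents raises the major index by each
  of \<open>0, \<dots>, m\<close> once, if the copies of \<open>n\<close> to the right of the new one are counted as well, and it
  creates a new descent exactly for the increments above \<open>s + c\<close>. The factor \<open>1 - q ^ (k + 1)\<close>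
  accounts for the choice of the inserted copy among the \<open>k + 1\<close> equal letters.

  For excedances and Denert's statistic no comparably simple insertion is used. Instead the
  letters and the places of the word are added alternately, in the order in which letters reach
  the thresholds \<open>max h (x + g)\<close> of the places. A place may then be declared an excedance place
  before the letter that will stand there is available; it is a hole until then. Let \<open>\<Psi> x\<close> be the
  generating function of such partial words with \<open>x\<close> holes. Adding a place expresses the new \<open>\<Psi> x\<close>
  by \<open>\<Psi> x\<close> and \<open>\<Psi> (x - 1)\<close> (\<open>hole_gf_add_place\<close>), adding a letter expresses it by \<open>\<Psi> x\<close> and
  \<open>\<Psi> (x + 1)\<close> (\<open>hole_gf_add_letter\<close>). The key fact is that both steps preserve one functional
  equation between \<open>\<Psi> (x + 1)\<close> and \<open>\<Psi> x\<close> (\<open>hole_relation\<close>). For \<open>x = 0\<close> this equation eliminates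
  \<open>\<Psi> 1\<close> from the letter step, and the recursion above results (\<open>partial_gf_eq_maj_gf\<close>).
\<close>

section \<open>Marked letters and \<open>q\<close>-numbers\<close>

definition q_number :: "'a::comm_ring_1 \<Rightarrow> nat \<Rightarrow> 'a" where
  "q_number q k = (\<Sum>j<k. q ^ j)"

lemma q_number_0 [simp]: "q_number q 0 = 0"
  by (simp add: q_number_def)

lemma q_number_Suc: "q_number q (Suc k) = q_number q k + q ^ k"
  by (simp add: q_number_def)

lemma q_number_Suc_shift: "q_number q (Suc k) = 1 + q * q_number q k"
  by (simp add: q_number_def sum.lessThan_Suc_shift sum_distrib_left del: sum.lessThan_Suc)

lemma q_number_add: "q_number q (a + b) = q_number q a + q ^ a * q_number q b"
  by (induction b) (simp_all add: q_number_Suc algebra_simps power_add)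

lemma one_minus_times_q_number: "(1 - q) * q_number q k = 1 - q ^ k"
  by (simp add: q_number_def one_diff_power_eq)

lemma sum_marked_occurrences:
  "(\<Sum>i\<in>{i. i < length w \<and> w ! i = a}. q ^ count (mset (drop (Suc i) w)) a)
     = q_number q (count (mset w) a)"
proof -
  have "(\<Sum>i<length w. if w ! i = a then q ^ count (mset (drop (Suc i) w)) a else 0)
      = q_number q (count (mset w) a)"
    by (induction w) (simp_all add: sum.lessThan_Suc_shift q_number_Suc del: sum.lessThan_Suc cong: if_cong)
  moreover have "{i. i < length w \<and> w ! i = a} = {i \<in> {..<length w}. w ! i = a}"
    by auto
  ultimately show ?thesis
    by (simp only: sum.inter_filter finite_lessThan)
qed

lemma sum_marked_occurrences_before:
  "(\<Sum>i\<in>{i. i < length w \<and> w ! i = a}. q ^ count (mset (take i w)) a)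
     = q_number q (count (mset w) a)"
proof -
  have "(\<Sum>i<length w. if w ! i = a then q ^ count (mset (take i w)) a else 0)
      = q_number q (count (mset w) a)"
  proof (induction w)
    case (Cons b w)
    have "(\<Sum>i<length w. if w ! i = a then q ^ count (mset (take (Suc i) (b # w))) a else 0)
        = q ^ of_bool (b = a) * (\<Sum>i<length w. if w ! i = a then q ^ count (mset (take i w)) a else 0)"
      unfolding sum_distrib_left by (intro sum.cong) auto
    then show ?case
      by (simp add: sum.lessThan_Suc_shift q_number_Suc_shift Cons.IH del: sum.lessThan_Suc take_Suc_Cons)
  qed simp
  moreover have "{i. i < length w \<and> w ! i = a} = {i \<in> {..<length w}. w ! i = a}"
    by auto
  ultimately show ?thesis
    by (simp only: sum.inter_filter finite_lessThan)
qed

text \<open>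
  Inserting a letter \<open>a\<close> into \<open>w\<close> at different places can give the same word. Recording the
  place means marking one copy of \<open>a\<close> in the result, and the factor
  \<open>q ^ count (mset (drop i w)) a\<close>, the number of copies to the right of the mark, makes the
  marked copies of one word add up to a \<open>q\<close>-number. This does for words, one letter at a
  time, what standardisation to permutations would do in one go.
\<close>

lemma sum_permutations_add_mset:
  fixes f :: "nat list \<Rightarrow> 'a::comm_ring_1"
  shows "q_number q (Suc (count N a)) * (\<Sum>w\<in>permutations_of_multiset (add_mset a N). f w)
    = (\<Sum>w\<in>permutations_of_multiset N. \<Sum>i\<le>length w.
         q ^ count (mset (drop i w)) a * f (take i w @ a # drop i w))"
proof -
  let ?A = "permutations_of_multiset (add_mset a N)"
  let ?B = "permutations_of_multiset N"
  have "q_number q (Suc (count N a)) * (\<Sum>w\<in>?A. f w)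
      = (\<Sum>w\<in>?A. \<Sum>i\<in>{i. i < length w \<and> w ! i = a}. q ^ count (mset (drop (Suc i) w)) a * f w)"
    unfolding sum_distrib_left
    by (rule sum.cong)
      (auto simp: sum_marked_occurrences permutations_of_multiset_def simp flip: sum_distrib_right)
  also have "\<dots> = (\<Sum>(w, i)\<in>(SIGMA w:?A. {i. i < length w \<and> w ! i = a}).
       q ^ count (mset (drop (Suc i) w)) a * f w)"
    by (subst sum.Sigma) auto
  also have "\<dots> = (\<Sum>(w, i)\<in>(SIGMA w:?B. {..length w}).
       q ^ count (mset (drop i w)) a * f (take i w @ a # drop i w))"
  proof (rule sum.reindex_bij_witness[where
        i = "\<lambda>(w, i). (take i w @ a # drop i w, i)" and
        j = "\<lambda>(w, i). (take i w @ drop (Suc i) w, i)"])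
    fix p assume "p \<in> (SIGMA w:?A. {i. i < length w \<and> w ! i = a})"
    then obtain w i where p: "p = (w, i)" "mset w = add_mset a N" "i < length w" "w ! i = a"
      by (auto simp: permutations_of_multiset_def)
    have w: "take i w @ a # drop (Suc i) w = w"
      using id_take_nth_drop[of i w] p by simp
    have "mset (take i w @ a # drop (Suc i) w) = add_mset a N"
      using w p by simp
    then have m: "mset (take i w @ drop (Suc i) w) = N"
      by simp
    show "(case case p of (w, i) \<Rightarrow> (take i w @ drop (Suc i) w, i) of
            (w, i) \<Rightarrow> (take i w @ a # drop i w, i)) = p"
      using p w by (simp add: min_def)
    show "(case p of (w, i) \<Rightarrow> (take i w @ drop (Suc i) w, i)) \<in> (SIGMA w:?B. {..length w})"
      using p m by (auto simp: permutations_of_multiset_def)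
    show "(case case p of (w, i) \<Rightarrow> (take i w @ drop (Suc i) w, i) of
            (w, i) \<Rightarrow> q ^ count (mset (drop i w)) a * f (take i w @ a # drop i w)) =
          (case p of (w, i) \<Rightarrow> q ^ count (mset (drop (Suc i) w)) a * f w)"
      using p w by (simp add: min_def)
  next
    fix p assume "p \<in> (SIGMA w:?B. {..length w})"
    then obtain w i where p: "p = (w, i)" "mset w = N" "i \<le> length w"
      by (auto simp: permutations_of_multiset_def)
    have m: "mset (take i w) + mset (drop i w) = N"
      using p by (simp flip: mset_append)
    show "(case case p of (w, i) \<Rightarrow> (take i w @ a # drop i w, i) of
            (w, i) \<Rightarrow> (take i w @ drop (Suc i) w, i)) = p"
      using p by (simp add: min_def)
    show "(case p of (w, i) \<Rightarrow> (take i w @ a # drop i w, i))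
            \<in> (SIGMA w:?A. {i. i < length w \<and> w ! i = a})"
      using p m by (auto simp: permutations_of_multiset_def nth_append min_def)
  qed
  also have "\<dots> = (\<Sum>w\<in>?B. \<Sum>i\<le>length w.
         q ^ count (mset (drop i w)) a * f (take i w @ a # drop i w))"
    by (subst sum.Sigma) auto
  finally show ?thesis .
qed

section \<open>Inserting a largest letter: descents and major index\<close>

primrec pair_count :: "(nat \<Rightarrow> nat \<Rightarrow> bool) \<Rightarrow> nat list \<Rightarrow> nat" where
  "pair_count P [] = 0"
| "pair_count P (x # w) = length (filter (P x) w) + pair_count P w"

lemma letter_Cons: "letter (x # w) (Suc i) = (if i = 0 then x else letter w i)"
  by (cases i) (auto simp: letter_def)

lemma card_positions_letter:
  "card {i \<in> {1..length w}. P (letter w i)} = length (filter P w)"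
proof -
  have "{i \<in> {1..length w}. P (letter w i)} = Suc ` {i. i < length w \<and> P (w ! i)}"
    by (auto simp: letter_def image_iff gr0_conv_Suc Suc_le_eq)
  then show ?thesis
    by (simp add: card_image length_filter_conv_card)
qed

lemma card_pairs_eq_pair_count:
  "card {(i, j) \<in> {1..length w} \<times> {1..length w}. i < j \<and> P (letter w i) (letter w j)}
     = pair_count P w"
proof (induction w)
  case Nil
  then show ?case by simp
next
  case (Cons x w)
  let ?S = "\<lambda>w. {(i, j) \<in> {1..length w} \<times> {1..length w}. i < j \<and> P (letter w i) (letter w j)}"
  let ?T = "{j \<in> {1..length w}. P x (letter w j)}"
  have eq: "?S (x # w) = (\<lambda>j. (1, Suc j)) ` ?T \<union> map_prod Suc Suc ` ?S w" (is "?L = ?R1 \<union> ?R2")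
  proof (intro set_eqI iffI)
    fix p assume "p \<in> ?L"
    then obtain i j where p: "p = (Suc i, Suc j)" "i < j" "Suc i \<le> Suc (length w)" "Suc j \<le> Suc (length w)"
      "P (letter (x # w) (Suc i)) (letter (x # w) (Suc j))"
      by (cases p; cases "fst p"; cases "snd p") auto
    then show "p \<in> ?R1 \<union> ?R2"
      by (cases "i = 0") (auto simp: letter_Cons image_iff)
  qed (auto simp: letter_Cons)
  have "finite (?S w)"
    by (rule finite_subset[of _ "{1..length w} \<times> {1..length w}"]) auto
  then have "card (?S (x # w)) = card ?R1 + card ?R2"
    unfolding eq by (intro card_Un_disjoint) auto
  also have "card ?R1 = card ?T"
    by (intro card_image inj_onI) auto
  also have "card ?R2 = card (?S w)"
    by (intro card_image inj_onI) auto
  finally show ?case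
    by (simp only: Cons.IH card_positions_letter pair_count.simps)
qed

definition front_descent :: "nat \<Rightarrow> nat \<Rightarrow> nat \<Rightarrow> nat list \<Rightarrow> bool" where
  "front_descent g l x w \<longleftrightarrow> w \<noteq> [] \<and> hd w + g \<le> x \<and> l \<le> hd w"

abbreviation gap_inversion :: "nat \<Rightarrow> nat \<Rightarrow> nat \<Rightarrow> nat \<Rightarrow> bool" where
  "gap_inversion g l x y \<equiv> y < x \<and> (y < l \<or> x < y + g)"

lemma gap_Des_Cons:
  "gap_Des g l (x # w) = (if front_descent g l x w then {1} else {}) \<union> Suc ` gap_Des g l w"
proof (intro set_eqI iffI)
  fix i assume i: "i \<in> gap_Des g l (x # w)"
  show "i \<in> (if front_descent g l x w then {1} else {}) \<union> Suc ` gap_Des g l w"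
  proof (cases "i = 1")
    case True
    then show ?thesis
      using i by (cases w) (auto simp: gap_Des_def front_descent_def letter_def)
  next
    case False
    then obtain j where "i = Suc j" "j \<ge> 1"
      using i by (cases i) (auto simp: gap_Des_def)
    then show ?thesis
      using i by (auto simp: gap_Des_def letter_Cons)
  qed
next
  fix i assume "i \<in> (if front_descent g l x w then {1} else {}) \<union> Suc ` gap_Des g l w"
  then show "i \<in> gap_Des g l (x # w)"
    by (cases w) (auto simp: gap_Des_def letter_Cons front_descent_def letter_def split: if_splits)
qed

lemma finite_gap_Des [simp]: "finite (gap_Des g l w)"
  by (simp add: gap_Des_def)

lemma zero_notin_gap_Des [simp]: "0 \<notin> gap_Des g l w"
  by (simp add: gap_Des_def)

lemma gap_des_Nil [simp]: "gap_des g l [] = 0"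
  by (simp add: gap_des_def gap_Des_def)

lemma gap_des_Cons:
  "gap_des g l (x # w) = of_bool (front_descent g l x w) + gap_des g l w"
proof -
  have "1 \<notin> Suc ` gap_Des g l w"
    by auto
  then show ?thesis
    by (simp add: gap_des_def gap_Des_Cons card_image card_insert_if)
qed

lemma gap_maj_eq:
  "gap_maj g l w = \<Sum>(gap_Des g l w) + pair_count (gap_inversion g l) w"
  using card_pairs_eq_pair_count[of w "gap_inversion g l"]
  by (simp add: gap_maj_def gap_Inv_def)

lemma gap_maj_Nil [simp]: "gap_maj g l [] = 0"
  by (simp add: gap_maj_eq gap_Des_def)

lemma gap_maj_Cons:
  "gap_maj g l (x # w) = of_bool (front_descent g l x w) + gap_des g l w
     + length (filter (gap_inversion g l x) w) + gap_maj g l w"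
proof -
  have "\<Sum>(Suc ` gap_Des g l w) = gap_des g l w + \<Sum>(gap_Des g l w)"
    by (simp add: sum.reindex gap_des_def sum_Suc)
  then show ?thesis
    by (auto simp: gap_maj_eq gap_Des_Cons sum.insert_if)
qed

text \<open>
  Putting \<open>x\<close> in front of \<open>w\<close> moves every descent one place to the right, so the major index
  grows by the number of descents. In a generating function this is the substitution
  \<open>t \<mapsto> t * q\<close> (see \<open>maj_weight_Cons\<close>), which is why all weights keep \<open>t\<close> as a free
  ring element.
\<close>

definition maj_weight :: "nat \<Rightarrow> nat \<Rightarrow> 'a::comm_ring_1 \<Rightarrow> 'a \<Rightarrow> nat list \<Rightarrow> 'a" where
  "maj_weight g l q t w = t ^ gap_des g l w * q ^ gap_maj g l w"

lemma maj_weight_shift: "maj_weight g l q (t * q) w = q ^ gap_des g l w * maj_weight g l q t w"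
  by (simp add: maj_weight_def power_mult_distrib algebra_simps)

lemma maj_weight_Cons:
  "maj_weight g l q t (x # w) = (t * q) ^ of_bool (front_descent g l x w)
     * q ^ length (filter (gap_inversion g l x) w) * maj_weight g l q (t * q) w"
  by (simp add: maj_weight_def gap_des_Cons gap_maj_Cons power_mult_distrib power_add algebra_simps)

lemma maj_weight_insert_front:
  assumes "\<And>y. y \<in> set w \<Longrightarrow> y \<le> n" and "g \<ge> 1"
  shows "q ^ count (mset w) n * maj_weight g l q t (n # w)
    = (t * q) ^ of_bool (front_descent g l n w)
        * q ^ (gap_des g l w + length (filter (\<lambda>y. y < l \<or> n < y + g) w)) * maj_weight g l q t w"
proof -
  have "count (mset w) n + length (filter (gap_inversion g l n) w)
      = length (filter (\<lambda>y. y < l \<or> n < y + g) w)"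
    using assms by (induction w) (auto simp: le_less)
  then have "q ^ count (mset w) n * q ^ length (filter (gap_inversion g l n) w)
      = q ^ length (filter (\<lambda>y. y < l \<or> n < y + g) w)"
    by (simp flip: power_add)
  then show ?thesis
    by (simp only: maj_weight_Cons maj_weight_shift power_add flip: \<open>q ^ count _ _ * _ = _\<close>)
      (simp only: mult_ac)
qed

text \<open>
  Carlitz insertion. Let \<open>c\<close> be the number of letters of \<open>w\<close> before which a largest letter \<open>n\<close>
  forms no descent, and \<open>s\<close> the number of descents of \<open>w\<close>. Of the \<open>length w + 1\<close> slots, exactly
  \<open>s + c + 1\<close> create no new descent: those inside descents, those before the \<open>c\<close> letters, and the
  end. Add to the increment of the major index the number of copies of \<open>n\<close> right of the slot. The
  results are \<open>0, \<dots>, s + c\<close> over these slots and \<open>s + c + 1, \<dots>, length w\<close> over the others. The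
  induction removes the first letter of \<open>w\<close>; only the slot just behind that letter is
  exceptional, since inserting there may split a descent.
\<close>

lemma sum_maj_weight_insert:
  assumes "\<And>y. y \<in> set w \<Longrightarrow> y \<le> n" and "g \<ge> 1"
  shows "(\<Sum>i\<le>length w. q ^ count (mset (drop i w)) n * maj_weight g l q t (take i w @ n # drop i w))
    = maj_weight g l q t w
      * ((1 - t) * q_number q (Suc (gap_des g l w + length (filter (\<lambda>y. y < l \<or> n < y + g) w)))
         + t * q_number q (Suc (length w)))"
  using assms
proof (induction w arbitrary: t)
  case Nil
  then show ?case
    by (simp add: maj_weight_def gap_des_Cons gap_maj_Cons front_descent_def q_number_Suc)
next
  case (Cons x w)
  let ?c = "length (filter (\<lambda>y. y < l \<or> n < y + g) w)"
  let ?s = "gap_des g l w"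
  let ?r = "length (filter (gap_inversion g l x) w)"
  let ?D = "front_descent g l x w"
  let ?W = "maj_weight g l q (t * q)"
  define F where "F = (\<lambda>i. q ^ count (mset (drop i w)) n * ?W (take i w @ n # drop i w))"
  define A where "A = q_number q (Suc (?s + ?c))"
  define P where "P = q ^ (?s + ?c)"
  define \<omega> where "\<omega> = q ^ ?r * ?W w"
  have x: "x \<le> n"
    using Cons.prems by simp
  have IH: "(\<Sum>i\<le>length w. F i)
      = ?W w * ((1 - t * q) * A + t * q * q_number q (Suc (length w)))"
    unfolding F_def A_def using Cons.prems by (intro Cons.IH) auto
  have A1: "q_number q (Suc (Suc (?s + ?c))) = A + q * P"
    by (simp add: A_def P_def q_number_Suc[of _ "Suc _"])
  have A2: "q_number q (Suc (Suc (?s + ?c))) = 1 + q * A"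
    by (simp add: A_def q_number_Suc_shift[of _ "Suc _"])
  have A3: "q_number q (Suc (Suc (Suc (?s + ?c)))) = A + q * P + q * q * P"
    by (simp add: A_def P_def q_number_Suc[of _ "Suc _"])
  have A4: "q * P = 1 + q * A - A"
    using A1 A2 by (simp add: algebra_simps)
  have L: "q_number q (Suc (Suc (length w))) = 1 + q * q_number q (Suc (length w))"
    by (rule q_number_Suc_shift)
  have front: "q ^ count (mset (x # w)) n * maj_weight g l q t (n # x # w)
      = (t * q) ^ of_bool (\<not> (x < l \<or> n < x + g))
        * q ^ of_bool ?D * q ^ of_bool (x < l \<or> n < x + g) * P * ((t * q) ^ of_bool ?D * \<omega>)"
  proof -
    have "gap_des g l (x # w) + length (filter (\<lambda>y. y < l \<or> n < y + g) (x # w))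
        = of_bool ?D + of_bool (x < l \<or> n < x + g) + (?s + ?c)"
      by (simp add: gap_des_Cons)
    moreover have "front_descent g l n (x # w) \<longleftrightarrow> \<not> (x < l \<or> n < x + g)"
      by (auto simp: front_descent_def)
    moreover have "maj_weight g l q t (x # w) = (t * q) ^ of_bool ?D * \<omega>"
      by (simp add: maj_weight_Cons \<omega>_def)
    ultimately show ?thesis
      using maj_weight_insert_front[of "x # w" n g q l t] Cons.prems
      by (simp only: power_add P_def) (simp only: mult_ac)
  qed
  have F0: "F 0 = (t * q * q) ^ of_bool (front_descent g l n w) * P * ?W w"
    unfolding F_def P_def using Cons.prems by (simp add: maj_weight_insert_front)
  have step: "q ^ count (mset (drop i w)) n * maj_weight g l q t (x # take i w @ n # drop i w)
      = (if i = 0 then q ^ ?r * F 0 else (t * q) ^ of_bool ?D * q ^ ?r * F i)"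
    if "i \<le> length w" for i
  proof -
    have "filter (gap_inversion g l x) (take i w @ n # drop i w)
        = filter (gap_inversion g l x) (take i w) @ filter (gap_inversion g l x) (drop i w)"
      using x by simp
    also have "\<dots> = filter (gap_inversion g l x) w"
      by (simp flip: filter_append)
    finally have "length (filter (gap_inversion g l x) (take i w @ n # drop i w)) = ?r"
      by simp
    moreover have "front_descent g l x (take i w @ n # drop i w) \<longleftrightarrow> i \<noteq> 0 \<and> ?D"
      using x that Cons.prems(2) by (cases w; cases i) (auto simp: front_descent_def)
    ultimately show ?thesis
      by (auto simp: maj_weight_Cons F_def algebra_simps)
  qed
  have "(\<Sum>i\<le>length w. q ^ count (mset (drop i w)) n * maj_weight g l q t (x # take i w @ n # drop i w))
      = (\<Sum>i\<le>length w. if i = 0 then q ^ ?r * F 0 else (t * q) ^ of_bool ?D * q ^ ?r * F i)"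
    by (intro sum.cong) (auto simp: step)
  also have "\<dots> = (\<Sum>i\<le>length w. (t * q) ^ of_bool ?D * q ^ ?r * F i
      + (if i = 0 then (1 - (t * q) ^ of_bool ?D) * q ^ ?r * F 0 else 0))"
    by (intro sum.cong) (auto simp: algebra_simps)
  also have "\<dots> = (t * q) ^ of_bool ?D * q ^ ?r * (\<Sum>i\<le>length w. F i)
      + (1 - (t * q) ^ of_bool ?D) * q ^ ?r * F 0"
    by (simp add: sum.distrib sum_distrib_left)
  finally have tail: "(\<Sum>i\<le>length w. q ^ count (mset (drop i w)) n * maj_weight g l q t (x # take i w @ n # drop i w))
      = (t * q) ^ of_bool ?D * \<omega> * ((1 - t * q) * A + t * q * q_number q (Suc (length w)))
        + (1 - (t * q) ^ of_bool ?D) * q ^ ?r * F 0"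
    by (simp add: IH \<omega>_def algebra_simps)
  have "(\<Sum>i\<le>length (x # w). q ^ count (mset (drop i (x # w))) n
        * maj_weight g l q t (take i (x # w) @ n # drop i (x # w)))
      = q ^ count (mset (x # w)) n * maj_weight g l q t (n # x # w)
       + (\<Sum>i\<le>length w. q ^ count (mset (drop i w)) n * maj_weight g l q t (x # take i w @ n # drop i w))"
    unfolding length_Cons by (subst sum.atMost_Suc_shift) simp
  also have "\<dots> = (t * q) ^ of_bool ?D * \<omega>
      * ((1 - t) * q_number q (Suc (of_bool ?D + ?s + of_bool (x < l \<or> n < x + g) + ?c))
         + t * q_number q (Suc (Suc (length w))))"
  proof (cases ?D)
    case True
    then have "front_descent g l n w"
      using x by (auto simp: front_descent_def)
    then have F0': "q ^ ?r * F 0 = t * q * q * P * \<omega>"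
      by (simp add: F0 \<omega>_def algebra_simps)
    \<comment> \<open>All four cases differ from the claim by a multiple of the relation \<open>A4\<close>.\<close>
    have ring1: "q * q * P * (t * q * \<omega>)
        + (t * q * \<omega> * ((1 - t * q) * A + t * q * T) + (1 - t * q) * (t * q * q * P * \<omega>))
      = t * q * \<omega> * ((1 - t) * (A + q * P + q * q * P) + t * (1 + q * T))" (is "?X = ?Y") for T
    proof -
      have "?X = ?Y + t * q * \<omega> * t * (q * P - (1 + q * A - A))"
        by (simp add: algebra_simps)
      then show ?thesis
        by (simp add: A4)
    qed
    have ring2: "t * q * q * P * (t * q * \<omega>)
        + (t * q * \<omega> * ((1 - t * q) * A + t * q * T) + (1 - t * q) * (t * q * q * P * \<omega>))
      = t * q * \<omega> * ((1 - t) * (A + q * P) + t * (1 + q * T))" (is "?X = ?Y") for T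
    proof -
      have "?X = ?Y + t * q * \<omega> * t * (q * P - (1 + q * A - A))"
        by (simp add: algebra_simps)
      then show ?thesis
        by (simp add: A4)
    qed
    have \<omega>t: "(1 - t * q) * q ^ ?r * F 0 = (1 - t * q) * (t * q * q * P * \<omega>)"
      by (simp add: F0' mult.assoc)
    show ?thesis
    proof (cases "x < l \<or> n < x + g")
      case True
      then show ?thesis
        unfolding front tail L using \<open>?D\<close> ring1[of "q_number q (Suc (length w))"]
        by (simp add: \<omega>t A3 flip: mult.assoc)
    next
      case False
      then show ?thesis
        unfolding front tail L using \<open>?D\<close> ring2[of "q_number q (Suc (length w))"]
        by (simp add: \<omega>t A1 flip: mult.assoc)
    qed
  next
    case False
    have ring3: "q * P * \<omega> + \<omega> * ((1 - t * q) * A + t * q * T)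
      = \<omega> * ((1 - t) * (A + q * P) + t * (1 + q * T))" (is "?X = ?Y") for T
    proof -
      have "?X = ?Y + \<omega> * t * (q * P - (1 + q * A - A))"
        by (simp add: algebra_simps)
      then show ?thesis
        by (simp add: A4)
    qed
    have ring4: "t * q * P * \<omega> + \<omega> * ((1 - t * q) * A + t * q * T)
      = \<omega> * ((1 - t) * A + t * (1 + q * T))" (is "?X = ?Y") for T
    proof -
      have "?X = ?Y + \<omega> * t * (q * P - (1 + q * A - A))"
        by (simp add: algebra_simps)
      then show ?thesis
        by (simp add: A4)
    qed
    show ?thesis
    proof (cases "x < l \<or> n < x + g")
      case True
      then show ?thesis
        unfolding front tail L using False ring3[of "q_number q (Suc (length w))"]
        by (simp add: A1 flip: mult.assoc)
    next
      case False
      then show ?thesis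
        unfolding front tail L using \<open>\<not> ?D\<close> ring4[of "q_number q (Suc (length w))"]
        by (simp add: A_def[symmetric] flip: mult.assoc)
    qed
  qed
  also have "(t * q) ^ of_bool ?D * \<omega> = maj_weight g l q t (x # w)"
    by (simp add: \<omega>_def maj_weight_Cons algebra_simps)
  also have "of_bool ?D + ?s + of_bool (x < l \<or> n < x + g) + ?c
      = gap_des g l (x # w) + length (filter (\<lambda>y. y < l \<or> n < y + g) (x # w))"
    by (simp add: gap_des_Cons)
  finally show ?case
    by simp
qed

text \<open>
  Multiplication by \<open>1 - q\<close> turns \<open>q_number q (s + c + 1)\<close> into \<open>1 - q ^ (s + c + 1)\<close>, and
  \<open>q ^ s\<close> is absorbed by \<open>t \<mapsto> t * q\<close>. The insertion rule becomes an equation for the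
  generating function alone.
\<close>

definition maj_gf :: "nat \<Rightarrow> nat \<Rightarrow> 'a::comm_ring_1 \<Rightarrow> nat multiset \<Rightarrow> 'a \<Rightarrow> 'a" where
  "maj_gf g l q M t = (\<Sum>w\<in>permutations_of_multiset M. maj_weight g l q t w)"

lemma maj_gf_add_max:
  fixes l :: nat
  assumes "\<And>y. y \<in># M \<Longrightarrow> y \<le> n" and "g \<ge> 1"
  defines "c \<equiv> size (filter_mset (\<lambda>y. y < l \<or> n < y + g) M)"
  shows "(1 - q ^ Suc (count M n)) * maj_gf g l q (add_mset n M) t
    = (1 - t) * (maj_gf g l q M t - q ^ Suc c * maj_gf g l q M (t * q))
      + t * (1 - q ^ Suc (size M)) * maj_gf g l q M t"
proof -
  have ins: "(\<Sum>i\<le>length w. q ^ count (mset (drop i w)) n * maj_weight g l q t (take i w @ n # drop i w))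
      = maj_weight g l q t w
        * ((1 - t) * q_number q (Suc (gap_des g l w + c)) + t * q_number q (Suc (size M)))"
    if "w \<in> permutations_of_multiset M" for w
  proof -
    have w: "mset w = M"
      using that by (simp add: permutations_of_multiset_def)
    then have "length w = size M" "c = length (filter (\<lambda>y. y < l \<or> n < y + g) w)"
      by (auto simp: c_def simp flip: mset_filter)
    moreover have "\<And>y. y \<in> set w \<Longrightarrow> y \<le> n"
      using w assms by auto
    ultimately show ?thesis
      using sum_maj_weight_insert[of w n g q l t] assms(2) by simp
  qed
  have "(1 - q ^ Suc (count M n)) * maj_gf g l q (add_mset n M) t
      = (1 - q) * (q_number q (Suc (count M n)) * maj_gf g l q (add_mset n M) t)"
    by (simp only: one_minus_times_q_number flip: mult.assoc)
  also have "\<dots> = (\<Sum>w\<in>permutations_of_multiset M. (1 - q) * (maj_weight g l q t w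
      * ((1 - t) * q_number q (Suc (gap_des g l w + c)) + t * q_number q (Suc (size M)))))"
    unfolding maj_gf_def sum_permutations_add_mset
    by (simp only: ins sum_distrib_left cong: sum.cong)
  also have "\<dots> = (\<Sum>w\<in>permutations_of_multiset M. maj_weight g l q t w
      * ((1 - t) * (1 - q ^ Suc (gap_des g l w + c)) + t * (1 - q ^ Suc (size M))))"
    by (intro sum.cong refl) (simp only: flip: one_minus_times_q_number; simp only: algebra_simps)
  also have "\<dots> = (\<Sum>w\<in>permutations_of_multiset M. (1 - t) * maj_weight g l q t w
      - (1 - t) * q ^ Suc c * maj_weight g l q (t * q) w
      + t * (1 - q ^ Suc (size M)) * maj_weight g l q t w)"
    unfolding maj_weight_shift by (intro sum.cong refl) (simp add: power_add algebra_simps)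
  also have "\<dots> = (1 - t) * (maj_gf g l q M t - q ^ Suc c * maj_gf g l q M (t * q))
      + t * (1 - q ^ Suc (size M)) * maj_gf g l q M t"
    by (simp only: sum.distrib sum_subtractf maj_gf_def flip: sum_distrib_left)
      (simp add: algebra_simps)
  finally show ?thesis .
qed

section \<open>Words with holes\<close>

text \<open>
  A word is read as a list of cells together with a word of its non-excedance letters: a \<open>Gap\<close>
  is a place whose letter is taken from the second word, \<open>Exc a\<close> an excedance place with
  letter \<open>a\<close>, and \<open>Hole\<close> an excedance place whose letter is not yet available. Letters
  become available in weakly increasing order.
\<close>

datatype cell = Gap | Hole | Exc nat

fun cell_letters :: "cell list \<Rightarrow> nat multiset" where
  "cell_letters [] = {#}"
| "cell_letters (Exc a # u) = add_mset a (cell_letters u)"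
| "cell_letters (_ # u) = cell_letters u"

lemma cell_letters_append [simp]: "cell_letters (u @ v) = cell_letters u + cell_letters v"
  by (induction u rule: cell_letters.induct) auto

lemma count_cell_letters: "count (cell_letters u) a = count (mset u) (Exc a)"
  by (induction u rule: cell_letters.induct) auto

lemma length_cells:
  "length u = count (mset u) Gap + count (mset u) Hole + size (cell_letters u)"
  by (induction u rule: cell_letters.induct) auto

text \<open>
  A hole will receive a letter at least as large as the present ones, and dominates them all.
  A pair of holes contributes nothing yet: only pairs whose right member is a letter count.
\<close>

fun dominates :: "cell \<Rightarrow> nat \<Rightarrow> bool" where
  "dominates Gap a \<longleftrightarrow> False"
| "dominates Hole a \<longleftrightarrow> True"
| "dominates (Exc b) a \<longleftrightarrow> a \<le> b"

primrec cell_imv :: "cell list \<Rightarrow> nat" where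
  "cell_imv [] = 0"
| "cell_imv (c # u) = size (filter_mset (dominates c) (cell_letters u)) + cell_imv u"

lemma cell_imv_snoc: "cell_letters [c] = {#} \<Longrightarrow> cell_imv (u @ [c]) = cell_imv u"
  by (induction u) auto

text \<open>
  Filling a hole with a largest letter creates new weak inversions with the holes and the copies
  of \<open>n\<close> on its left. To its right nothing changes, as \<open>n\<close> dominates what the hole dominated.
\<close>

lemma cell_imv_Hole_to_Exc:
  assumes "\<And>b. b \<in># cell_letters us \<Longrightarrow> b \<le> n" and "\<And>b. b \<in># cell_letters vs \<Longrightarrow> b \<le> n"
  shows "cell_imv (us @ Exc n # vs)
    = cell_imv (us @ Hole # vs) + count (mset us) Hole + count (mset us) (Exc n)"
  using assms(1)
proof (induction us)
  case Nil
  have "filter_mset (dominates (Exc n)) (cell_letters vs) = filter_mset (dominates Hole) (cell_letters vs)"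
    using assms(2) by (intro filter_mset_cong) auto
  then show ?case
    by simp
next
  case (Cons c us)
  have IH: "cell_imv (us @ Exc n # vs)
    = cell_imv (us @ Hole # vs) + count (mset us) Hole + count (mset us) (Exc n)"
    using Cons.prems by (intro Cons.IH) (cases c; auto)
  then show ?case
    using Cons.prems[of "case c of Exc b \<Rightarrow> b | _ \<Rightarrow> 0"] by (cases c) auto
qed

text \<open>
  Here \<open>fs\<close> lists the thresholds of the places: a letter at a place is an excedance iff it
  reaches the threshold. The word \<open>z\<close> may be longer than the number of gaps. Its surplus
  letters wait for places that are not yet present.
\<close>

definition gap_bounds :: "cell list \<Rightarrow> nat list \<Rightarrow> nat list" where
  "gap_bounds u fs = map snd (filter (\<lambda>(c, f). c = Gap) (zip u fs))"

definition fillable :: "cell list \<Rightarrow> nat list \<Rightarrow> nat list \<Rightarrow> bool" where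
  "fillable u fs z \<longleftrightarrow> (\<forall>(c, f)\<in>set (zip u fs). \<forall>a. c = Exc a \<longrightarrow> f \<le> a)
     \<and> length (gap_bounds u fs) \<le> length z
     \<and> (\<forall>k<length (gap_bounds u fs). z ! k < gap_bounds u fs ! k)"

lemma length_gap_bounds: "length u = length fs \<Longrightarrow> length (gap_bounds u fs) = count (mset u) Gap"
  by (induction u fs rule: list_induct2) (auto simp: gap_bounds_def)

lemma set_gap_bounds_subset: "set (gap_bounds u fs) \<subseteq> set fs"
  by (auto simp: gap_bounds_def dest: set_zip_rightD)

lemma gap_bounds_snoc:
  "length u = length fs \<Longrightarrow> gap_bounds (u @ [c]) (fs @ [f]) = gap_bounds u fs @ (if c = Gap then [f] else [])"
  by (simp add: gap_bounds_def)

lemma fillable_snoc: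
  assumes "length u = length fs"
  shows "fillable (u @ [Gap]) (fs @ [f]) z \<longleftrightarrow>
           fillable u fs z \<and> count (mset u) Gap < length z \<and> z ! count (mset u) Gap < f"
    and "fillable (u @ [Hole]) (fs @ [f]) z \<longleftrightarrow> fillable u fs z"
    and "fillable (u @ [Exc a]) (fs @ [f]) z \<longleftrightarrow> fillable u fs z \<and> f \<le> a"
proof -
  note len = length_gap_bounds[OF assms]
  show "fillable (u @ [Gap]) (fs @ [f]) z \<longleftrightarrow>
           fillable u fs z \<and> count (mset u) Gap < length z \<and> z ! count (mset u) Gap < f"
    using assms by (auto simp: fillable_def gap_bounds_snoc len nth_append less_Suc_eq)
qed (use assms in \<open>auto simp: fillable_def gap_bounds_snoc\<close>)

lemma fillable_Hole_to_Exc: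
  assumes "length (us @ Hole # vs) = length fs" and "\<And>f. f \<in> set fs \<Longrightarrow> f \<le> n"
  shows "fillable (us @ Exc n # vs) fs z = fillable (us @ Hole # vs) fs z"
proof -
  define f where "f = fs ! length us"
  have fs: "fs = take (length us) fs @ f # drop (Suc (length us)) fs" (is "_ = ?a @ f # ?b")
    unfolding f_def using assms(1) by (intro id_take_nth_drop) auto
  have "f \<le> n"
    using assms by (simp add: f_def)
  have len: "length us = length ?a"
    using assms(1) by simp
  have zip: "zip (us @ c # vs) fs = zip us ?a @ (c, f) # zip vs ?b" for c
  proof -
    have "zip (us @ c # vs) (?a @ f # ?b) = zip us ?a @ (c, f) # zip vs ?b"
      using len by (simp only: zip_append zip_Cons_Cons)
    then show ?thesis
      by (simp only: fs[symmetric])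
  qed
  show ?thesis
    unfolding fillable_def gap_bounds_def zip using \<open>f \<le> n\<close> by auto
qed

abbreviation inv_count :: "nat list \<Rightarrow> nat" where
  "inv_count \<equiv> pair_count (\<lambda>x y. y < x)"

lemma inv_count_insert_max:
  assumes "\<And>y. y \<in> set (a @ b) \<Longrightarrow> y \<le> n"
  shows "inv_count (a @ n # b) + count (mset b) n = inv_count (a @ b) + length b"
  using assms
proof (induction a)
  case Nil
  have "length (filter (\<lambda>y. y < n) b) + count (mset b) n = length b"
    using Nil by (induction b) (auto simp: le_less)
  then show ?case by simp
qed (auto simp: not_less)

text \<open>
  This is the sum over all arrangements of the non-excedance letters \<open>N\<close>, both those in the gaps
  of \<open>u\<close> and those still waiting.
\<close>

definition fill_gf :: "nat list \<Rightarrow> 'a::comm_ring_1 \<Rightarrow> cell list \<Rightarrow> nat multiset \<Rightarrow> 'a" where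
  "fill_gf fs q u N = (\<Sum>z\<in>permutations_of_multiset N. if fillable u fs z then q ^ inv_count z else 0)"

lemma sum_power_diff: "(\<Sum>i\<le>m. if k \<le> i then q ^ (m - i) else 0) = q_number q (Suc m - k)"
proof -
  have "(\<Sum>i\<le>m. if k \<le> i then q ^ (m - i) else 0) = (\<Sum>i\<in>{i \<in> {..m}. k \<le> i}. q ^ (m - i))"
    by (subst sum.inter_filter) auto
  also have "\<dots> = (\<Sum>j<Suc m - k. q ^ j)"
    by (rule sum.reindex_bij_witness[of _ "\<lambda>j. m - j" "\<lambda>i. m - i"]) auto
  finally show ?thesis by (simp add: q_number_def)
qed

text \<open>
  A letter that reaches all thresholds cannot be put into a gap. It can be inserted exactly
  behind the letters in the gaps, where it creates one inversion with each smaller letter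
  to its right.
\<close>

lemma fill_gf_add_max:
  assumes len: "length u = length fs" and N: "\<And>y. y \<in># N \<Longrightarrow> y \<le> n" and fs: "\<And>f. f \<in> set fs \<Longrightarrow> f \<le> n"
  shows "q_number q (Suc (count N n)) * fill_gf fs q u (add_mset n N)
    = q_number q (Suc (size N) - count (mset u) Gap) * fill_gf fs q u N"
proof -
  let ?o = "count (mset u) Gap"
  have ins: "(\<Sum>i\<le>length z. q ^ count (mset (drop i z)) n *
      (if fillable u fs (take i z @ n # drop i z) then q ^ inv_count (take i z @ n # drop i z) else 0))
      = q_number q (Suc (size N) - ?o) * (if fillable u fs z then q ^ inv_count z else 0)"
    if "z \<in> permutations_of_multiset N" for z
  proof -
    have z: "mset z = N"
      using that by (simp add: permutations_of_multiset_def)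
    have fill: "fillable u fs (take i z @ n # drop i z) \<longleftrightarrow> ?o \<le> i \<and> fillable u fs z"
      if i: "i \<le> length z" for i
    proof (cases "?o \<le> i")
      case True
      then show ?thesis
        using i by (auto simp: fillable_def length_gap_bounds[OF len] nth_append)
    next
      case False
      then have "gap_bounds u fs ! i \<in> set (gap_bounds u fs)"
        by (simp add: length_gap_bounds[OF len])
      then have "gap_bounds u fs ! i \<in> set fs"
        using set_gap_bounds_subset by blast
      then have "\<not> (take i z @ n # drop i z) ! i < gap_bounds u fs ! i"
        using fs i by (simp add: nth_append not_less)
      then show ?thesis
        using False by (auto simp: fillable_def length_gap_bounds[OF len])
    qed
    have inv: "q ^ count (mset (drop i z)) n * q ^ inv_count (take i z @ n # drop i z)
        = q ^ (length z - i) * q ^ inv_count z" if "i \<le> length z" for i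
      using inv_count_insert_max[of "take i z" "drop i z" n] N z that
      by (auto simp flip: power_add simp: add.commute)
    have "(\<Sum>i\<le>length z. q ^ count (mset (drop i z)) n *
      (if fillable u fs (take i z @ n # drop i z) then q ^ inv_count (take i z @ n # drop i z) else 0))
      = (\<Sum>i\<le>length z. (if ?o \<le> i then q ^ (length z - i) else 0) * (if fillable u fs z then q ^ inv_count z else 0))"
      by (intro sum.cong refl) (simp add: fill inv)
    also have "\<dots> = q_number q (Suc (size N) - ?o) * (if fillable u fs z then q ^ inv_count z else 0)"
      using z by (simp only: flip: sum_distrib_right) (simp add: sum_power_diff flip: z)
    finally show ?thesis .
  qed
  show ?thesis
    unfolding fill_gf_def sum_permutations_add_mset
    by (simp only: ins sum_distrib_left cong: sum.cong)
qed

text \<open>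
  Places are numbered from 0 here, so place \<open>i\<close> contributes \<open>Suc i\<close>. The first \<open>L\<close> places
  do not contribute to the excedance number; in the application the sorted word is below the
  level there.
\<close>

definition cell_weight :: "nat \<Rightarrow> (nat \<Rightarrow> nat) \<Rightarrow> 'a::comm_ring_1 \<Rightarrow> 'a \<Rightarrow> cell list \<Rightarrow> 'a" where
  "cell_weight L B q t u =
     (\<Prod>i<length u. if u ! i = Gap then 1 else (if L \<le> i then t else 1) * q ^ Suc i)
     * q ^ ((\<Sum>a\<in>#cell_letters u. B a) + cell_imv u)"

definition cell_lists :: "nat \<Rightarrow> nat \<Rightarrow> nat multiset \<Rightarrow> cell list set" where
  "cell_lists r x M = {u. length u = r \<and> count (mset u) Hole = x \<and> cell_letters u \<subseteq># M}"

lemma finite_cell_lists [simp]: "finite (cell_lists r x M)"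
proof (rule finite_subset)
  have "set u \<subseteq> {Gap, Hole} \<union> Exc ` set_mset (cell_letters u)" for u
    by (induction u rule: cell_letters.induct) auto
  then show "cell_lists r x M \<subseteq> {u. set u \<subseteq> {Gap, Hole} \<union> Exc ` set_mset M \<and> length u = r}"
    by (fastforce simp: cell_lists_def dest: set_mset_mono)
qed (intro finite_lists_length_eq; simp)

text \<open>
  The central object: \<open>x\<close> counts the holes, \<open>fs\<close> holds the thresholds of the places present, and
  \<open>M\<close> is the multiset of letters present. Without holes, and with all places and all letters
  present, it is the generating function of the excedance number and Denert's statistic.
\<close>

definition hole_gf ::
  "nat \<Rightarrow> (nat \<Rightarrow> nat) \<Rightarrow> 'a::comm_ring_1 \<Rightarrow> nat list \<Rightarrow> nat multiset \<Rightarrow> nat \<Rightarrow> 'a \<Rightarrow> 'a" where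
  "hole_gf L B q fs M x t =
     (\<Sum>u\<in>cell_lists (length fs) x M. cell_weight L B q t u * fill_gf fs q u (M - cell_letters u))"

lemma cell_weight_snoc:
  assumes "cell_letters [c] = {#}"
  shows "cell_weight L B q t (u @ [c]) = cell_weight L B q t u
    * (if c = Gap then 1 else (if L \<le> length u then t else 1) * q ^ Suc (length u))"
proof -
  have "(\<Prod>i<length u. if (u @ [c]) ! i = Gap then 1 else (if L \<le> i then t else 1) * q ^ Suc i)
      = (\<Prod>i<length u. if u ! i = Gap then 1 else (if L \<le> i then t else 1) * q ^ Suc i)"
    by (intro prod.cong) (auto simp: nth_append)
  then show ?thesis
    using assms by (simp add: cell_weight_def cell_imv_snoc mult_ac)
qed

lemma cell_weight_Hole_to_Exc:
  assumes "\<And>b. b \<in># cell_letters (us @ vs) \<Longrightarrow> b \<le> n"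
  shows "cell_weight L B q t (us @ Exc n # vs) = cell_weight L B q t (us @ Hole # vs)
    * q ^ (B n + count (mset us) Hole + count (mset us) (Exc n))"
proof -
  have "(\<Prod>i<length (us @ Exc n # vs). if (us @ Exc n # vs) ! i = Gap then 1 else (if L \<le> i then t else 1) * q ^ Suc i)
      = (\<Prod>i<length (us @ Hole # vs). if (us @ Hole # vs) ! i = Gap then 1 else (if L \<le> i then t else 1) * q ^ Suc i)"
    by (intro prod.cong) (auto simp: nth_append nth_Cons split: nat.splits)
  then show ?thesis
    using assms by (simp add: cell_weight_def cell_imv_Hole_to_Exc power_add mult_ac)
qed

text \<open>
  A new place beyond the reach of all letters present is either a gap or a hole. In the first case
  the word of non-excedance letters is unchanged: its first waiting letter moves into the gap.
\<close>

lemma hole_gf_add_place: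
  assumes M: "\<And>y. y \<in># M \<Longrightarrow> y < f" and size: "length fs < size M"
  shows "hole_gf L B q (fs @ [f]) M x t = hole_gf L B q fs M x t
    + (if x = 0 then 0
       else (if L \<le> length fs then t else 1) * q ^ Suc (length fs) * hole_gf L B q fs M (x - 1) t)"
proof -
  let ?r = "length fs"
  let ?G = "\<lambda>u. cell_weight L B q t u * fill_gf (fs @ [f]) q u (M - cell_letters u)"
  let ?A = "(\<lambda>u. u @ [Gap]) ` cell_lists ?r x M"
  let ?B = "if x = 0 then {} else (\<lambda>u. u @ [Hole]) ` cell_lists ?r (x - 1) M"
  have sub: "?A \<union> ?B \<subseteq> cell_lists (Suc ?r) x M"
    by (auto simp: cell_lists_def)
  have zero: "?G u = 0" if "u \<in> cell_lists (Suc ?r) x M - (?A \<union> ?B)" for u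
  proof -
    have "length u = Suc ?r"
      using that by (simp add: cell_lists_def)
    then obtain v c where u: "u = v @ [c]" and v: "length v = ?r"
      by (metis length_Suc_conv_rev)
    have "c \<noteq> Gap"
      using that by (auto simp: cell_lists_def u v image_iff)
    moreover have "c \<noteq> Hole"
      using that by (auto simp: cell_lists_def u v image_iff)
    ultimately obtain a where c: "c = Exc a"
      by (cases c) auto
    have "a \<in># M"
      using that by (auto simp: cell_lists_def u c dest: mset_subset_eq_insertD)
    then have "\<not> f \<le> a"
      using M by (simp add: not_le)
    then show ?thesis
      using v by (simp add: fill_gf_def u c fillable_snoc)
  qed
  have gap: "?G (u @ [Gap]) = cell_weight L B q t u * fill_gf fs q u (M - cell_letters u)"
    if "u \<in> cell_lists ?r x M" for u
  proof -
    have u: "length u = ?r" "cell_letters u \<subseteq># M"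
      using that by (auto simp: cell_lists_def)
    have "fillable (u @ [Gap]) (fs @ [f]) z \<longleftrightarrow> fillable u fs z"
      if "z \<in> permutations_of_multiset (M - cell_letters u)" for z
    proof -
      have z: "mset z = M - cell_letters u"
        using that by (simp add: permutations_of_multiset_def)
      have "length z = size M - size (cell_letters u)"
        using u z by (metis size_Diff_submset size_mset)
      moreover have "size (cell_letters u) + count (mset u) Gap \<le> ?r"
        using length_cells[of u] u by simp
      ultimately have o: "count (mset u) Gap < length z"
        using size by simp
      then have "z ! count (mset u) Gap \<in># M"
        using z by (metis in_diffD nth_mem set_mset_mset)
      then show ?thesis
        using M o u by (simp add: fillable_snoc)
    qed
    then have "fill_gf (fs @ [f]) q (u @ [Gap]) (M - cell_letters u) = fill_gf fs q u (M - cell_letters u)"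
      unfolding fill_gf_def by (intro sum.cong) auto
    then show ?thesis
      by (simp add: cell_weight_snoc)
  qed
  have hole: "?G (u @ [Hole]) = (if L \<le> ?r then t else 1) * q ^ Suc ?r
      * (cell_weight L B q t u * fill_gf fs q u (M - cell_letters u))"
    if "u \<in> cell_lists ?r y M" for u y
    using that by (simp add: cell_weight_snoc fill_gf_def fillable_snoc cell_lists_def mult_ac)
  have "hole_gf L B q (fs @ [f]) M x t = sum ?G (?A \<union> ?B)"
    unfolding hole_gf_def using sub zero by (intro sum.mono_neutral_right) auto
  also have "\<dots> = sum ?G ?A + sum ?G ?B"
    by (intro sum.union_disjoint) auto
  also have "sum ?G ?A = hole_gf L B q fs M x t"
    unfolding hole_gf_def by (subst sum.reindex) (auto simp: inj_on_def gap simp del: cell_letters_append intro!: sum.cong)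
  also have "sum ?G ?B = (if x = 0 then 0
       else (if L \<le> length fs then t else 1) * q ^ Suc (length fs) * hole_gf L B q fs M (x - 1) t)"
  proof (cases "x = 0")
    case False
    have "sum ?G ((\<lambda>u. u @ [Hole]) ` cell_lists ?r (x - 1) M)
        = (\<Sum>u\<in>cell_lists ?r (x - 1) M. ?G (u @ [Hole]))"
      by (subst sum.reindex) (auto simp: inj_on_def)
    also have "\<dots> = (if L \<le> ?r then t else 1) * q ^ Suc ?r * hole_gf L B q fs M (x - 1) t"
      unfolding hole_gf_def sum_distrib_left by (intro sum.cong refl hole)
    finally show ?thesis
      using False by simp
  qed simp
  finally show ?thesis .
qed

text \<open>
  Mark one copy of the new largest letter. If the marked copy is a non-excedance, removing it
  leaves the \<open>size M - length fs + x + 1\<close> insertion places among the waiting letters. If it is an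
  excedance, erasing it leaves a hole, and the position of that hole among all \<open>x + 1\<close> holes gives
  the \<open>q\<close>-number. The hypothesis on \<open>B\<close> makes the exponent of the second case independent of
  everything else.
\<close>

lemma hole_gf_add_letter:
  assumes M: "\<And>y. y \<in># M \<Longrightarrow> y \<le> n" and fs: "\<And>f. f \<in> set fs \<Longrightarrow> f \<le> n"
    and size: "length fs \<le> size M"
    and B: "fs \<noteq> [] \<Longrightarrow> B n + count M n = size M - length fs"
  shows "q_number q (Suc (count M n)) * hole_gf L B q fs (add_mset n M) x t
    = q_number q (Suc (size M - length fs + x)) * hole_gf L B q fs M x t
      + q ^ (size M - length fs) * q_number q (Suc x) * hole_gf L B q fs M (Suc x) t"
proof -
  let ?r = "length fs"
  let ?k = "Suc (count M n)"
  let ?M = "add_mset n M"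
  let ?w = "cell_weight L B q t"
  let ?F = "\<lambda>u N. fill_gf fs q u (N - cell_letters u)"
  let ?e = "\<lambda>u. count (cell_letters u) n"
  let ?C = "cell_lists ?r x ?M"
  let ?D = "cell_lists ?r (Suc x) M"
  have split: "q_number q ?k = q_number q (?k - ?e u) + q ^ (?k - ?e u) * q_number q (?e u)"
    if "u \<in> ?C" for u
  proof -
    have "?e u \<le> ?k"
      using that mset_subset_eq_count[of "cell_letters u" ?M n] by (simp add: cell_lists_def)
    then show ?thesis
      by (simp flip: q_number_add)
  qed
  have "q_number q ?k * hole_gf L B q fs ?M x t = (\<Sum>u\<in>?C. q_number q ?k * (?w u * ?F u ?M))"
    by (simp add: hole_gf_def sum_distrib_left)
  also have "\<dots> = (\<Sum>u\<in>?C. q_number q (?k - ?e u) * (?w u * ?F u ?M)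
      + q ^ (?k - ?e u) * q_number q (?e u) * (?w u * ?F u ?M))"
    by (intro sum.cong refl, subst split) (auto simp: algebra_simps)
  also have "\<dots> = (\<Sum>u\<in>?C. q_number q (?k - ?e u) * (?w u * ?F u ?M))
      + (\<Sum>u\<in>?C. q ^ (?k - ?e u) * q_number q (?e u) * (?w u * ?F u ?M))"
    by (rule sum.distrib)
  also have "(\<Sum>u\<in>?C. q_number q (?k - ?e u) * (?w u * ?F u ?M))
      = q_number q (Suc (size M - ?r + x)) * hole_gf L B q fs M x t"
  proof -
    have sub: "cell_lists ?r x M \<subseteq> ?C"
      by (auto simp: cell_lists_def subset_mset.le_iff_add)
    have zero: "q_number q (?k - ?e u) * (?w u * ?F u ?M) = 0" if "u \<in> ?C - cell_lists ?r x M" for u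
    proof -
      have u: "cell_letters u \<subseteq># ?M" "\<not> cell_letters u \<subseteq># M"
        using that by (auto simp: cell_lists_def)
      have "?e u \<ge> ?k"
      proof (rule ccontr)
        assume "\<not> ?e u \<ge> ?k"
        then have "count (cell_letters u) a \<le> count M a" for a
          using mset_subset_eq_count[OF u(1), of a] by (cases "a = n") auto
        then show False
          using u(2) by (simp add: subseteq_mset_def)
      qed
      then show ?thesis
        by simp
    qed
    have main: "q_number q (?k - ?e u) * (?w u * ?F u ?M) = q_number q (Suc (size M - ?r + x)) * (?w u * ?F u M)"
      if "u \<in> cell_lists ?r x M" for u
    proof -
      have u: "length u = ?r" "count (mset u) Hole = x" "cell_letters u \<subseteq># M"
        using that by (auto simp: cell_lists_def)
      let ?N = "M - cell_letters u"
      have N: "?M - cell_letters u = add_mset n ?N"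
        using mset_subset_eq_count[OF u(3), of n] by (intro multiset_eqI) (auto simp: Suc_diff_le)
      have k: "?k - ?e u = Suc (count ?N n)"
        using mset_subset_eq_count[OF u(3), of n] by simp
      have y: "Suc (size ?N) - count (mset u) Gap = Suc (size M - ?r + x)"
        using length_cells[of u] u size size_mset_mono[OF u(3)] by (simp add: size_Diff_submset)
      have "b \<le> n" if "b \<in># ?N" for b
        using M that by (meson in_diffD)
      then have "q_number q (Suc (count ?N n)) * fill_gf fs q u (add_mset n ?N)
          = q_number q (Suc (size ?N) - count (mset u) Gap) * fill_gf fs q u ?N"
        using u(1) fs by (intro fill_gf_add_max) auto
      then have "q_number q (?k - ?e u) * ?F u ?M = q_number q (Suc (size M - ?r + x)) * ?F u M"
        by (simp only: k y N)
      then show ?thesis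
        by (simp add: mult.left_commute)
    qed
    have "(\<Sum>u\<in>?C. q_number q (?k - ?e u) * (?w u * ?F u ?M))
        = (\<Sum>u\<in>cell_lists ?r x M. q_number q (?k - ?e u) * (?w u * ?F u ?M))"
      using sub zero by (intro sum.mono_neutral_right) auto
    also have "\<dots> = (\<Sum>u\<in>cell_lists ?r x M. q_number q (Suc (size M - ?r + x)) * (?w u * ?F u M))"
      by (intro sum.cong refl main)
    finally show ?thesis
      by (simp add: hole_gf_def sum_distrib_left)
  qed
  also have "(\<Sum>u\<in>?C. q ^ (?k - ?e u) * q_number q (?e u) * (?w u * ?F u ?M))
      = q ^ (size M - ?r) * q_number q (Suc x) * hole_gf L B q fs M (Suc x) t"
  proof -
    \<comment> \<open>Expand \<open>q_number q (?e u)\<close> over the marked copy, then trade that copy for a hole.\<close>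
    have "(\<Sum>u\<in>?C. q ^ (?k - ?e u) * q_number q (?e u) * (?w u * ?F u ?M))
        = (\<Sum>u\<in>?C. \<Sum>i\<in>{i. i < length u \<and> u ! i = Exc n}.
             q ^ (?k - ?e u) * q ^ count (mset (drop (Suc i) u)) (Exc n) * (?w u * ?F u ?M))"
      by (intro sum.cong refl)
        (simp add: count_cell_letters sum_marked_occurrences flip: sum_distrib_right sum_distrib_left)
    also have "\<dots> = (\<Sum>(u, i)\<in>(SIGMA u:?C. {i. i < length u \<and> u ! i = Exc n}).
             q ^ (?k - ?e u) * q ^ count (mset (drop (Suc i) u)) (Exc n) * (?w u * ?F u ?M))"
      by (subst sum.Sigma) auto
    also have "\<dots> = (\<Sum>(u, i)\<in>(SIGMA u:?D. {i. i < length u \<and> u ! i = Hole}).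
             q ^ (size M - ?r) * q ^ count (mset (take i u)) Hole * (?w u * ?F u M))"
    proof (rule sum.reindex_bij_witness[where
          i = "\<lambda>(u, i). (u[i := Exc n], i)" and j = "\<lambda>(u, i). (u[i := Hole], i)"])
      fix p assume "p \<in> (SIGMA u:?C. {i. i < length u \<and> u ! i = Exc n})"
      then obtain u i where p: "p = (u, i)" and uC: "u \<in> ?C" and i: "i < length u" "u ! i = Exc n"
        by auto
      define us vs where "us = take i u" and "vs = drop (Suc i) u"
      have u: "u = us @ Exc n # vs"
        using id_take_nth_drop[OF i(1)] i(2) by (simp add: us_def vs_def)
      have li: "length us = i"
        using i by (simp add: us_def)
      have upd: "u[i := Hole] = us @ Hole # vs"
        using i by (simp add: us_def vs_def upd_conv_take_nth_drop)
      have len: "length (us @ Hole # vs) = ?r" and holes: "count (mset (us @ vs)) Hole = x"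
        and sub: "cell_letters (us @ vs) \<subseteq># M"
        using uC by (auto simp: cell_lists_def u)
      show "(case case p of (u, i) \<Rightarrow> (u[i := Hole], i) of (u, i) \<Rightarrow> (u[i := Exc n], i)) = p"
        using i list_update_id[of u i] by (simp add: p)
      show "(case p of (u, i) \<Rightarrow> (u[i := Hole], i)) \<in> (SIGMA u:?D. {i. i < length u \<and> u ! i = Hole})"
      proof -
        have "us @ Hole # vs \<in> ?D"
          using len holes sub by (simp add: cell_lists_def)
        moreover have "(us @ Hole # vs) ! i = Hole"
          by (simp flip: li)
        moreover have "i < length (us @ Hole # vs)"
          by (simp flip: li)
        ultimately show ?thesis
          unfolding p prod.case upd by blast
      qed
      have le: "b \<le> n" if "b \<in># cell_letters (us @ vs)" for b
        using M[OF mset_subset_eqD[OF sub that]] .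
      have "fs \<noteq> []"
        using len by auto
      then have "B n + count M n = size M - ?r"
        by (rule B)
      moreover have "count (mset us) (Exc n) + count (mset vs) (Exc n) \<le> count M n"
        using mset_subset_eq_count[OF sub, of n] by (simp add: count_cell_letters)
      ultimately have ex: "(?k - ?e u) + count (mset vs) (Exc n)
            + (B n + count (mset us) Hole + count (mset us) (Exc n))
          = size M - ?r + count (mset us) Hole"
        by (simp add: u count_cell_letters)
      have F: "?F (us @ Exc n # vs) ?M = ?F (us @ Hole # vs) M"
        unfolding fill_gf_def using fillable_Hole_to_Exc[OF len fs] by simp
      have F': "?F u ?M = ?F (us @ Hole # vs) M"
        using F by (simp only: u)
      have w: "?w u = ?w (us @ Hole # vs) * q ^ (B n + count (mset us) Hole + count (mset us) (Exc n))"
        unfolding u using le by (rule cell_weight_Hole_to_Exc)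
      have "q ^ (?k - ?e u) * q ^ count (mset vs) (Exc n) * (?w u * ?F u ?M)
          = q ^ ((?k - ?e u) + count (mset vs) (Exc n)
            + (B n + count (mset us) Hole + count (mset us) (Exc n))) * (?w (us @ Hole # vs) * ?F (us @ Hole # vs) M)"
        unfolding w F' by (simp only: power_add mult_ac)
      also have "\<dots> = q ^ (size M - ?r) * q ^ count (mset us) Hole
          * (?w (us @ Hole # vs) * ?F (us @ Hole # vs) M)"
        by (simp only: ex power_add)
      finally show "(case case p of (u, i) \<Rightarrow> (u[i := Hole], i) of (u, i) \<Rightarrow>
            q ^ (size M - ?r) * q ^ count (mset (take i u)) Hole * (?w u * ?F u M))
          = (case p of (u, i) \<Rightarrow> q ^ (?k - ?e u) * q ^ count (mset (drop (Suc i) u)) (Exc n) * (?w u * ?F u ?M))"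
        unfolding p prod.case upd vs_def[symmetric] using li by simp
    next
      fix p assume "p \<in> (SIGMA u:?D. {i. i < length u \<and> u ! i = Hole})"
      then obtain u i where p: "p = (u, i)" and uD: "u \<in> ?D" and i: "i < length u" "u ! i = Hole"
        by auto
      define us vs where "us = take i u" and "vs = drop (Suc i) u"
      have u: "u = us @ Hole # vs"
        using id_take_nth_drop[OF i(1)] i(2) by (simp add: us_def vs_def)
      have upd: "u[i := Exc n] = us @ Exc n # vs"
        using i by (simp add: us_def vs_def upd_conv_take_nth_drop)
      have li: "length us = i"
        using i by (simp add: us_def)
      show "(case case p of (u, i) \<Rightarrow> (u[i := Exc n], i) of (u, i) \<Rightarrow> (u[i := Hole], i)) = p"
        using i list_update_id[of u i] by (simp add: p)
      show "(case p of (u, i) \<Rightarrow> (u[i := Exc n], i)) \<in> (SIGMA u:?C. {i. i < length u \<and> u ! i = Exc n})"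
      proof -
        have "us @ Exc n # vs \<in> ?C"
          using uD by (simp add: cell_lists_def u)
        moreover have "(us @ Exc n # vs) ! i = Exc n"
          by (simp flip: li)
        moreover have "i < length (us @ Exc n # vs)"
          by (simp flip: li)
        ultimately show ?thesis
          unfolding p prod.case upd by blast
      qed
    qed
    also have "\<dots> = (\<Sum>u\<in>?D. \<Sum>i\<in>{i. i < length u \<and> u ! i = Hole}.
             q ^ (size M - ?r) * q ^ count (mset (take i u)) Hole * (?w u * ?F u M))"
      by (subst sum.Sigma) auto
    also have "\<dots> = (\<Sum>u\<in>?D. q ^ (size M - ?r) * q_number q (Suc x) * (?w u * ?F u M))"
    proof (intro sum.cong refl)
      fix u assume "u \<in> ?D"
      then have "count (mset u) Hole = Suc x"
        by (simp add: cell_lists_def)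
      then show "(\<Sum>i\<in>{i. i < length u \<and> u ! i = Hole}.
             q ^ (size M - ?r) * q ^ count (mset (take i u)) Hole * (?w u * ?F u M))
          = q ^ (size M - ?r) * q_number q (Suc x) * (?w u * ?F u M)"
        by (simp add: sum_marked_occurrences_before flip: sum_distrib_right sum_distrib_left)
    qed
    finally show ?thesis
      by (simp add: hole_gf_def sum_distrib_left)
  qed
  finally show ?thesis .
qed

section \<open>The functional equation relating consecutive numbers of holes\<close>

text \<open>
  The equation expresses \<open>x + 1\<close> holes through \<open>x\<close> holes. If \<open>\<Psi> x\<close> were \<open>t ^ s\<close> times
  a factor free of \<open>t\<close>, it would read, after division by \<open>1 - q\<close>,
  \<open>[x + 1] * \<Psi> (x + 1) = q * ([b + s] - [x] + t * ([r] - [b + s])) * \<Psi> x\<close>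
  with \<open>q\<close>-numbers in brackets: of the \<open>r\<close> places, the first \<open>b\<close> are not counted by \<open>t\<close>. The three
  lemmas below show that the relation is preserved when a letter or a place is added. In each of
  them the relation for the new family is a combination of two instances of the old one.
\<close>

definition hole_relation ::
  "'a::comm_ring_1 \<Rightarrow> nat \<Rightarrow> nat \<Rightarrow> (nat \<Rightarrow> 'a \<Rightarrow> 'a) \<Rightarrow> bool" where
  "hole_relation q b r \<Psi> \<longleftrightarrow> (\<forall>x t. (1 - q ^ Suc x) * \<Psi> (Suc x) t
     = q * ((q ^ x - t * q ^ r) * \<Psi> x t + (t - 1) * q ^ b * \<Psi> x (t * q)))"

lemma hole_relationD:
  "hole_relation q b r \<Psi> \<Longrightarrow> (1 - q ^ Suc x) * \<Psi> (Suc x) t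
     = q * ((q ^ x - t * q ^ r) * \<Psi> x t + (t - 1) * q ^ b * \<Psi> x (t * q))"
  by (simp add: hole_relation_def)

lemma hole_relation_add_letter:
  fixes q :: "'a::idom"
  assumes rel: "hole_relation q b r \<Psi>" and D: "D \<noteq> 0"
    and step: "\<And>x t. D * \<Psi>' x t
      = (1 - q ^ Suc (y + x)) * \<Psi> x t + q ^ y * (1 - q ^ Suc x) * \<Psi> (Suc x) t"
  shows "hole_relation q b r \<Psi>'"
  unfolding hole_relation_def
proof (intro allI)
  fix x t
  let ?R = "\<lambda>x t. (1 - q ^ Suc x) * \<Psi> (Suc x) t
     - q * ((q ^ x - t * q ^ r) * \<Psi> x t + (t - 1) * q ^ b * \<Psi> x (t * q))"
  have R: "?R x t = 0" for x t
    using hole_relationD[OF rel] by simp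
  have "D * ((1 - q ^ Suc x) * \<Psi>' (Suc x) t
        - q * ((q ^ x - t * q ^ r) * \<Psi>' x t + (t - 1) * q ^ b * \<Psi>' x (t * q)))
      = (1 - q ^ Suc x) * (D * \<Psi>' (Suc x) t)
        - q * ((q ^ x - t * q ^ r) * (D * \<Psi>' x t) + (t - 1) * q ^ b * (D * \<Psi>' x (t * q)))"
    by (simp add: algebra_simps)
  also have "\<dots> = (1 - q ^ Suc x) * q ^ y * ?R (Suc x) t + (1 - q ^ Suc (y + x)) * ?R x t"
    unfolding step by (simp add: power_add algebra_simps)
  also have "\<dots> = 0"
    by (simp only: R) simp
  finally show "(1 - q ^ Suc x) * \<Psi>' (Suc x) t
     = q * ((q ^ x - t * q ^ r) * \<Psi>' x t + (t - 1) * q ^ b * \<Psi>' x (t * q))"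
    using D by simp
qed

lemma hole_relation_add_counted_place:
  assumes rel: "hole_relation q b r \<Psi>"
    and step: "\<And>x t. \<Psi>' x t = \<Psi> x t + (if x = 0 then 0 else t * q ^ Suc r * \<Psi> (x - 1) t)"
  shows "hole_relation q b (Suc r) \<Psi>'"
  unfolding hole_relation_def
proof (intro allI)
  fix x t
  let ?R = "\<lambda>x t. (1 - q ^ Suc x) * \<Psi> (Suc x) t
     - q * ((q ^ x - t * q ^ r) * \<Psi> x t + (t - 1) * q ^ b * \<Psi> x (t * q))"
  have R: "?R x t = 0" for x t
    using hole_relationD[OF rel] by simp
  have "(1 - q ^ Suc x) * \<Psi>' (Suc x) t
        - q * ((q ^ x - t * q ^ Suc r) * \<Psi>' x t + (t - 1) * q ^ b * \<Psi>' x (t * q))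
      = ?R x t + (if x = 0 then 0 else t * q * q ^ Suc r * ?R (x - 1) t)"
    unfolding step by (cases x) (simp_all add: algebra_simps)
  also have "\<dots> = 0"
    by (simp only: R) simp
  finally show "(1 - q ^ Suc x) * \<Psi>' (Suc x) t
     = q * ((q ^ x - t * q ^ Suc r) * \<Psi>' x t + (t - 1) * q ^ b * \<Psi>' x (t * q))"
    by simp
qed

text \<open>
  While all places are uncounted, the family does not depend on \<open>t\<close>, and \<open>b\<close> grows together
  with \<open>r\<close>.
\<close>

lemma hole_relation_add_uncounted_place:
  assumes rel: "hole_relation q r r \<Psi>" and const: "\<And>x t. \<Psi> x (t * q) = \<Psi> x t"
    and step: "\<And>x t. \<Psi>' x t = \<Psi> x t + (if x = 0 then 0 else q ^ Suc r * \<Psi> (x - 1) t)"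
  shows "hole_relation q (Suc r) (Suc r) \<Psi>'"
  unfolding hole_relation_def
proof (intro allI)
  fix x t
  let ?R = "\<lambda>x t. (1 - q ^ Suc x) * \<Psi> (Suc x) t
     - q * ((q ^ x - t * q ^ r) * \<Psi> x t + (t - 1) * q ^ r * \<Psi> x (t * q))"
  have R: "?R x t = 0" for x t
    using hole_relationD[OF rel] by simp
  have "(1 - q ^ Suc x) * \<Psi>' (Suc x) t
        - q * ((q ^ x - t * q ^ Suc r) * \<Psi>' x t + (t - 1) * q ^ Suc r * \<Psi>' x (t * q))
      = ?R x t + (if x = 0 then 0 else q * q ^ Suc r * ?R (x - 1) t)"
    unfolding step const by (cases x) (simp_all add: algebra_simps)
  also have "\<dots> = 0"
    by (simp only: R) simp
  finally show "(1 - q ^ Suc x) * \<Psi>' (Suc x) t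
     = q * ((q ^ x - t * q ^ Suc r) * \<Psi>' x t + (t - 1) * q ^ Suc r * \<Psi>' x (t * q))"
    by simp
qed

lemma hole_gf_independent:
  assumes "length fs \<le> L"
  shows "hole_gf L B q fs M x t = hole_gf L B q fs M x s"
  unfolding hole_gf_def cell_weight_def
  by (intro sum.cong refl arg_cong2[of _ _ _ _ "(*)"] prod.cong)
    (use assms in \<open>auto simp: cell_lists_def\<close>)

lemma hole_gf_empty: "hole_gf L B q [] {#} x t = of_bool (x = 0)"
proof -
  have "cell_lists 0 x {#} = (if x = 0 then {[]} else {})"
    by (auto simp: cell_lists_def)
  then show ?thesis
    by (auto simp: hole_gf_def cell_weight_def fill_gf_def fillable_def gap_bounds_def)
qed

lemma nth_sorted_iff_less_length_filter:
  fixes ys :: "'a::linorder list"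
  assumes "sorted ys" and "j < length ys" and P: "\<And>x y. x \<le> y \<Longrightarrow> P y \<Longrightarrow> P x"
  shows "P (ys ! j) \<longleftrightarrow> j < length (filter P ys)"
  using assms(1,2)
proof (induction ys arbitrary: j)
  case (Cons y ys)
  show ?case
  proof (cases "P y")
    case True
    then show ?thesis
      using Cons by (cases j) auto
  next
    case False
    then have no: "\<not> P x" if "x \<in> set (y # ys)" for x
      using Cons.prems(1) P[of y x] that by auto
    have "filter P (y # ys) = []"
      using no by (simp add: filter_empty_conv)
    moreover have "\<not> P ((y # ys) ! j)"
      using no Cons.prems(2) nth_mem by blast
    ultimately show ?thesis
      by simp
  qed
qed simp

section \<open>Adding letters and places in increasing order\<close>

text \<open>
  The letters of a sorted word \<open>xs\<close> are added one at a time. Before a letter is added, so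
  are all places whose threshold it reaches. At each moment every letter present is then below
  the thresholds of the missing places, and the next letter reaches those of all
  places present, as the two recursions for \<open>hole_gf\<close> demand.
\<close>

locale gap_data =
  fixes g l h :: nat and xs :: "nat list" and q :: "'a::idom"
  assumes sorted_xs: "sorted xs" and g_pos: "1 \<le> g" and h_le: "h \<le> g + l"
    and q_power: "\<And>k. 0 < k \<Longrightarrow> q ^ k \<noteq> 1"
begin

definition thresholds :: "nat list" where
  "thresholds = map (\<lambda>x. max h (x + g)) xs"

definition low :: nat where
  "low = length (filter (\<lambda>y. y < l) xs)"

definition between :: "nat \<Rightarrow> nat" where
  "between a = length (filter (\<lambda>y. a < y + g \<and> y < a) xs)"

definition reach :: "nat \<Rightarrow> nat" where
  "reach n = length (filter (\<lambda>f. f \<le> n) thresholds)"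

abbreviation partial_gf :: "nat \<Rightarrow> nat \<Rightarrow> nat \<Rightarrow> 'a \<Rightarrow> 'a" where
  "partial_gf v r \<equiv> hole_gf low between q (take r thresholds) (mset (take v xs))"

lemma length_thresholds [simp]: "length thresholds = length xs"
  by (simp add: thresholds_def)

lemma sorted_thresholds: "sorted thresholds"
  unfolding thresholds_def sorted_map
  using sorted_xs by (rule sorted_wrt_mono_rel[rotated]) (auto simp: max_def)

lemma threshold_le_iff: "j < length xs \<Longrightarrow> thresholds ! j \<le> n \<longleftrightarrow> j < reach n"
  unfolding reach_def using sorted_thresholds
  by (intro nth_sorted_iff_less_length_filter) auto

lemma less_low_iff: "j < length xs \<Longrightarrow> xs ! j < l \<longleftrightarrow> j < low"
  unfolding low_def using sorted_xs
  by (intro nth_sorted_iff_less_length_filter) auto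

lemma mem_take_le: "v < length xs \<Longrightarrow> y \<in> set (take v xs) \<Longrightarrow> y \<le> xs ! v"
  using sorted_nth_mono[OF sorted_xs] by (auto simp: in_set_conv_nth)

lemma le_mem_drop: "v < length xs \<Longrightarrow> y \<in> set (drop v xs) \<Longrightarrow> xs ! v \<le> y"
  using sorted_nth_mono[OF sorted_xs] by (auto simp: in_set_conv_nth)

lemma nth_less_threshold: "j < length xs \<Longrightarrow> xs ! j < thresholds ! j"
  using g_pos by (simp add: thresholds_def)

lemma reach_mono: "a \<le> b \<Longrightarrow> reach a \<le> reach b"
proof -
  assume "a \<le> b"
  then have "length (filter (\<lambda>f. f \<le> a) ys) \<le> length (filter (\<lambda>f. f \<le> b) ys)" for ys
    by (induction ys) auto
  then show ?thesis
    by (simp add: reach_def)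
qed

lemma reach_le_length: "reach n \<le> length xs"
  using length_filter_le[of _ thresholds] by (simp add: reach_def)

lemma reach_le_index:
  assumes "v < length xs"
  shows "reach (xs ! v) \<le> v"
proof (rule ccontr)
  assume "\<not> reach (xs ! v) \<le> v"
  then have "thresholds ! v \<le> xs ! v"
    using assms by (simp add: threshold_le_iff)
  then show False
    using nth_less_threshold[OF assms] by simp
qed

lemma partial_gf_add_place:
  assumes "v \<le> length xs" and "r < v" and "\<And>i. i < v \<Longrightarrow> xs ! i < thresholds ! r"
  shows "partial_gf v (Suc r) x t = partial_gf v r x t
    + (if x = 0 then 0 else (if low \<le> r then t else 1) * q ^ Suc r * partial_gf v r (x - 1) t)"
proof -
  have "take (Suc r) thresholds = take r thresholds @ [thresholds ! r]"
    using assms by (simp add: take_Suc_conv_app_nth)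
  moreover have "length (take r thresholds) = r"
    using assms by simp
  moreover have "y < thresholds ! r" if "y \<in># mset (take v xs)" for y
    using that assms by (auto simp: in_set_conv_nth)
  ultimately show ?thesis
    using hole_gf_add_place[of "mset (take v xs)" "thresholds ! r" "take r thresholds" low between q x t] assms
    by (simp only: size_mset length_take min_absorb2)
qed

lemma hole_relation_add_place:
  assumes "v \<le> length xs" and "r < v" and "\<And>i. i < v \<Longrightarrow> xs ! i < thresholds ! r"
    and rel: "hole_relation q (min r low) r (partial_gf v r)"
  shows "hole_relation q (min (Suc r) low) (Suc r) (partial_gf v (Suc r))"
proof (cases "low \<le> r")
  case True
  then show ?thesis
    using rel partial_gf_add_place[OF assms(1-3)]
    by (auto simp: min_absorb2 intro!: hole_relation_add_counted_place)
next
  case False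
  have "partial_gf v r x (t * q) = partial_gf v r x t" for x t
    by (rule hole_gf_independent) (use False in simp)
  then have "hole_relation q (Suc r) (Suc r) (partial_gf v (Suc r))"
    using False rel partial_gf_add_place[OF assms(1-3)]
    by (intro hole_relation_add_uncounted_place[of q r "partial_gf v r"]) (simp_all add: min_absorb1)
  then show ?thesis
    using False by (simp add: min_absorb1 Suc_le_eq not_le)
qed

lemma hole_relation_add_places:
  assumes "r \<le> s" and "s \<le> v" and "v \<le> length xs"
    and reach: "\<And>i. i < v \<Longrightarrow> reach (xs ! i) \<le> r"
    and rel: "hole_relation q (min r low) r (partial_gf v r)"
  shows "hole_relation q (min s low) s (partial_gf v s) \<and> (\<forall>t. partial_gf v s 0 t = partial_gf v r 0 t)"
  using assms(1,2)
proof (induction s rule: dec_induct)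
  case base
  then show ?case
    using rel by simp
next
  case (step s)
  have "xs ! i < thresholds ! s" if "i < v" for i
  proof -
    have "\<not> s < reach (xs ! i)"
      using reach[OF that] step by simp
    then show ?thesis
      using threshold_le_iff[of s "xs ! i"] step assms(3) by simp
  qed
  then show ?case
    using step assms(3) hole_relation_add_place[of v s] partial_gf_add_place[of v s 0] by simp
qed

text \<open>
  Of the \<open>v\<close> letters preceding \<open>n = xs ! v\<close>, those not equal to \<open>n\<close> are smaller; they are
  either at distance at least \<open>g\<close> from \<open>n\<close>, and these are \<open>reach n\<close> many, or counted by
  \<open>between n\<close>. As some threshold is at most \<open>n\<close>, the level \<open>h\<close> is no obstacle.
\<close>

lemma between_add_count:
  assumes v: "v < length xs" and pos: "0 < reach (xs ! v)"
  shows "between (xs ! v) + count (mset (take v xs)) (xs ! v) = v - reach (xs ! v)"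
proof -
  let ?n = "xs ! v"
  have "thresholds ! 0 \<le> ?n"
    using pos v by (subst threshold_le_iff) auto
  moreover have "thresholds ! 0 = max h (xs ! 0 + g)"
    using v by (subst thresholds_def, subst nth_map) auto
  ultimately have h: "h \<le> ?n"
    by simp
  have reach: "reach ?n = length (filter (\<lambda>y. y + g \<le> ?n) xs)"
    using h by (simp add: reach_def thresholds_def filter_map comp_def)
  have below: "length (filter (\<lambda>y. y < ?n) xs) = between ?n + reach ?n"
  proof -
    have "length (filter (\<lambda>y. y < n) ys) = length (filter (\<lambda>y. n < y + g \<and> y < n) ys)
        + length (filter (\<lambda>y. y + g \<le> n) ys)" for n ys
      using g_pos by (induction ys) auto
    then show ?thesis
      by (simp only: reach between_def)
  qed
  have 1: "length (filter (\<lambda>y. y < ?n) (take v xs)) + count (mset (take v xs)) ?n = length (take v xs)"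
  proof -
    have "length (filter (\<lambda>y. y < n) ys) + count (mset ys) n = length ys"
      if "\<forall>y\<in>set ys. y \<le> n" for n :: nat and ys
      using that by (induction ys) auto
    then show ?thesis
      using mem_take_le[OF v] by blast
  qed
  have "\<not> y < ?n" if "y \<in> set (drop v xs)" for y
    using le_mem_drop[OF v that] by simp
  then have "filter (\<lambda>y. y < ?n) (drop v xs) = []"
    by (simp add: filter_empty_conv)
  then have "length (filter (\<lambda>y. y < ?n) xs) = length (filter (\<lambda>y. y < ?n) (take v xs))"
    by (metis append_Nil2 append_take_drop_id filter_append)
  then show ?thesis
    using 1 below v by simp
qed

text \<open>
  This identifies the number of letters that cannot end a descent from \<open>n = xs ! v\<close> with the
  parameters of the excedance side. The condition \<open>h \<le> g + l\<close> enters here: if \<open>n < h\<close>, no place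
  is within reach, and at the same time no letter of level \<open>l\<close> is \<open>g\<close> below \<open>n\<close>.
\<close>

lemma size_safe_letters:
  assumes v: "v < length xs"
  shows "size (filter_mset (\<lambda>y. y < l \<or> xs ! v < y + g) (mset (take v xs)))
    = v - reach (xs ! v) + min (reach (xs ! v)) low"
proof -
  let ?n = "xs ! v"
  let ?Q = "\<lambda>y. l \<le> y \<and> y + g \<le> ?n"
  have "length (filter (\<lambda>y. y < l \<or> ?n < y + g) ys) + length (filter ?Q ys) = length ys" for ys
    by (induction ys) auto
  from this[of "take v xs"]
  have 1: "size (filter_mset (\<lambda>y. y < l \<or> ?n < y + g) (mset (take v xs))) + length (filter ?Q (take v xs)) = v"
    using v by (simp flip: mset_filter)
  have "\<not> ?Q y" if "y \<in> set (drop v xs)" for y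
    using le_mem_drop[OF v that] g_pos by simp
  then have "filter ?Q (drop v xs) = []"
    unfolding filter_empty_conv by blast
  moreover have "filter ?Q xs = filter ?Q (take v xs) @ filter ?Q (drop v xs)"
    by (simp only: append_take_drop_id flip: filter_append)
  ultimately have 2: "length (filter ?Q (take v xs)) = length (filter ?Q xs)"
    by simp
  have 3: "length (filter ?Q xs) + min (reach ?n) low = reach ?n"
  proof (cases "h \<le> ?n")
    case True
    then have reach: "reach ?n = length (filter (\<lambda>y. y + g \<le> ?n) xs)"
      by (simp add: reach_def thresholds_def filter_map comp_def)
    have split: "length (filter ?Q xs) + length (filter (\<lambda>y. y < l \<and> y + g \<le> ?n) xs) = reach ?n"
    proof -
      have "length (filter (\<lambda>y. l \<le> y \<and> y + g \<le> n) ys)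
          + length (filter (\<lambda>y. y < l \<and> y + g \<le> n) ys) = length (filter (\<lambda>y. y + g \<le> n) ys)" for n ys
        by (induction ys) auto
      then show ?thesis
        by (simp only: reach)
    qed
    show ?thesis
    proof (cases "l + g \<le> Suc ?n")
      case True
      then have "filter (\<lambda>y. y < l \<and> y + g \<le> ?n) xs = filter (\<lambda>y. y < l) xs"
        by (intro filter_cong) auto
      then show ?thesis
        using split by (simp add: low_def)
    next
      case False
      then have eq: "filter (\<lambda>y. y < l \<and> y + g \<le> ?n) xs = filter (\<lambda>y. y + g \<le> ?n) xs"
        and none: "filter ?Q xs = []"
        by (auto intro!: filter_cong simp: filter_empty_conv)
      have "length (filter (\<lambda>y. y + g \<le> n) ys) \<le> length (filter (\<lambda>y. y < l) ys)"
        if "\<not> l + g \<le> Suc n" for n ys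
        using that by (induction ys) auto
      from this[OF False, of xs]
      have "length (filter (\<lambda>y. y + g \<le> ?n) xs) \<le> length (filter (\<lambda>y. y < l) xs)" .
      then show ?thesis
        using none reach by (simp add: low_def)
    qed
  next
    case False
    then have "reach ?n = 0"
      by (auto simp: reach_def thresholds_def filter_empty_conv)
    moreover have "filter ?Q xs = []"
      using False h_le by (auto simp: filter_empty_conv)
    ultimately show ?thesis
      by simp
  qed
  show ?thesis
    using 1 2 3 reach_le_index[OF v] by linarith
qed

lemma partial_gf_add_letter:
  assumes v: "v < length xs"
  defines "n \<equiv> xs ! v"
  shows "(1 - q ^ Suc (count (mset (take v xs)) n)) * partial_gf (Suc v) (reach n) x t
    = (1 - q ^ Suc (v - reach n + x)) * partial_gf v (reach n) x t
      + q ^ (v - reach n) * (1 - q ^ Suc x) * partial_gf v (reach n) (Suc x) t"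
proof -
  let ?M = "mset (take v xs)"
  let ?fs = "take (reach n) thresholds"
  have r: "reach n \<le> v"
    unfolding n_def using v by (rule reach_le_index)
  have M': "mset (take (Suc v) xs) = add_mset n ?M"
    using v by (simp add: n_def take_Suc_conv_app_nth)
  have len: "length ?fs = reach n"
    using r v by simp
  have size: "size ?M = v"
    using v by simp
  have "q_number q (Suc (count ?M n)) * hole_gf low between q ?fs (add_mset n ?M) x t
    = q_number q (Suc (size ?M - length ?fs + x)) * hole_gf low between q ?fs ?M x t
      + q ^ (size ?M - length ?fs) * q_number q (Suc x) * hole_gf low between q ?fs ?M (Suc x) t"
  proof (rule hole_gf_add_letter)
    show "y \<le> n" if "y \<in># ?M" for y
      using that mem_take_le[OF v] by (simp add: n_def)
    show "f \<le> n" if "f \<in> set ?fs" for f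
      using that r v threshold_le_iff by (auto simp: in_set_conv_nth)
    show "length ?fs \<le> size ?M"
      using len size r by simp
    show "between n + count ?M n = size ?M - length ?fs" if "?fs \<noteq> []"
      using between_add_count[OF v] that len size by (auto simp: n_def)
  qed
  then have "(1 - q) * (q_number q (Suc (count ?M n)) * partial_gf (Suc v) (reach n) x t)
    = (1 - q) * (q_number q (Suc (v - reach n + x)) * partial_gf v (reach n) x t
      + q ^ (v - reach n) * q_number q (Suc x) * partial_gf v (reach n) (Suc x) t)"
    by (simp only: M' len size)
  then have "(1 - q) * q_number q (Suc (count ?M n)) * partial_gf (Suc v) (reach n) x t
    = (1 - q) * q_number q (Suc (v - reach n + x)) * partial_gf v (reach n) x t
      + q ^ (v - reach n) * ((1 - q) * q_number q (Suc x)) * partial_gf v (reach n) (Suc x) t"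
    by (simp only: distrib_left mult_ac)
  then show ?thesis
    by (simp only: one_minus_times_q_number)
qed

text \<open>
  Without holes, \<open>partial_gf_add_letter\<close> involves one hole on the right-hand side. The functional
  equation eliminates it, and what remains is the recursion \<open>maj_gf_add_max\<close>. The places present
  after \<open>v\<close> letters are those within reach of the last of them.
\<close>

lemma partial_gf_eq_maj_gf:
  assumes "v \<le> length xs"
  defines "r \<equiv> (case v of 0 \<Rightarrow> 0 | Suc i \<Rightarrow> reach (xs ! i))"
  shows "hole_relation q (min r low) r (partial_gf v r)
    \<and> (\<forall>t. partial_gf v r 0 t = maj_gf g l q (mset (take v xs)) t)"
  using assms(1) unfolding r_def
proof (induction v)
  case 0
  have "hole_relation q 0 0 (\<lambda>x t. of_bool (x = 0))"
    unfolding hole_relation_def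
  proof (intro allI)
    fix x and t :: 'a
    show "(1 - q ^ Suc x) * of_bool (Suc x = 0)
      = q * ((q ^ x - t * q ^ 0) * of_bool (x = 0) + (t - 1) * q ^ 0 * of_bool (x = 0))"
      by (cases x) auto
  qed
  then show ?case
    by (simp add: hole_gf_empty maj_gf_def maj_weight_def)
next
  case (Suc v)
  let ?n = "xs ! v"
  let ?M = "mset (take v xs)"
  let ?r = "reach ?n"
  let ?s = "case v of 0 \<Rightarrow> 0 | Suc i \<Rightarrow> reach (xs ! i)"
  let ?D = "1 - q ^ Suc (count ?M ?n)"
  have v: "v < length xs"
    using Suc.prems by simp
  have r: "?r \<le> v"
    using v by (rule reach_le_index)
  have "reach (xs ! i) \<le> ?s" if "i < v" for i
    using that v by (cases v) (auto intro!: reach_mono sorted_nth_mono[OF sorted_xs])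
  moreover have "?s \<le> ?r"
    using v by (cases v) (auto intro!: reach_mono sorted_nth_mono[OF sorted_xs])
  ultimately have places: "hole_relation q (min ?r low) ?r (partial_gf v ?r)"
      "\<And>t. partial_gf v ?r 0 t = maj_gf g l q ?M t"
    using hole_relation_add_places[of ?s ?r v] Suc.IH v r by auto
  have D: "?D \<noteq> 0"
    using q_power[of "Suc (count ?M ?n)"] by simp
  have rel: "hole_relation q (min ?r low) ?r (partial_gf (Suc v) ?r)"
    using places(1) D partial_gf_add_letter[OF v] by (rule hole_relation_add_letter)
  have M': "mset (take (Suc v) xs) = add_mset ?n ?M"
    using v by (simp add: take_Suc_conv_app_nth)
  have "partial_gf (Suc v) ?r 0 t = maj_gf g l q (mset (take (Suc v) xs)) t" for t
  proof -
    let ?G = "maj_gf g l q ?M"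
    let ?c = "v - ?r + min ?r low"
    have G: "?D * maj_gf g l q (mset (take (Suc v) xs)) t
        = (1 - t) * (?G t - q ^ Suc ?c * ?G (t * q)) + t * (1 - q ^ Suc v) * ?G t"
      unfolding M' size_safe_letters[OF v, symmetric]
      by (subst maj_gf_add_max)
        (use v mem_take_le[OF v] g_pos in \<open>auto simp: min_absorb2\<close>)
    have "(1 - q ^ Suc 0) * partial_gf v ?r (Suc 0) t
        = q * ((1 - t * q ^ ?r) * ?G t + (t - 1) * q ^ min ?r low * ?G (t * q))"
      using hole_relationD[OF places(1), of 0 t] by (simp add: places(2))
    then have P: "?D * partial_gf (Suc v) ?r 0 t
        = (1 - q ^ Suc (v - ?r)) * ?G t + q ^ (v - ?r)
          * (q * ((1 - t * q ^ ?r) * ?G t + (t - 1) * q ^ min ?r low * ?G (t * q)))"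
      using partial_gf_add_letter[OF v, of 0 t] by (simp only: places(2) mult.assoc add_0_right)
    have "q ^ v = q ^ (v - ?r) * q ^ ?r"
      using r by (simp flip: power_add)
    then have "?D * partial_gf (Suc v) ?r 0 t = ?D * maj_gf g l q (mset (take (Suc v) xs)) t"
      unfolding G P by (simp add: power_add algebra_simps)
    then show ?thesis
      using D by simp
  qed
  then show ?case
    using rel by simp
qed

corollary hole_gf_eq_maj_gf:
  "hole_gf low between q thresholds (mset xs) 0 t = maj_gf g l q (mset xs) t"
proof -
  let ?m = "length xs"
  let ?r = "case ?m of 0 \<Rightarrow> 0 | Suc i \<Rightarrow> reach (xs ! i)"
  have "?r \<le> ?m"
    using reach_le_length by (auto split: nat.split)
  moreover have "reach (xs ! i) \<le> ?r" if "i < ?m" for i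
  proof -
    show ?thesis
      using that by (auto split: nat.split intro!: reach_mono sorted_nth_mono[OF sorted_xs])
  qed
  ultimately show ?thesis
    using hole_relation_add_places[of ?r ?m ?m] partial_gf_eq_maj_gf[of ?m] by simp
qed

end

section \<open>From words to cells: Denert's statistic\<close>

definition mark :: "nat list \<Rightarrow> nat list \<Rightarrow> cell list" where
  "mark fs w = map2 (\<lambda>f a. if f \<le> a then Exc a else Gap) fs w"

definition exceeding :: "nat list \<Rightarrow> nat list \<Rightarrow> nat list" where
  "exceeding fs w = map snd (filter (\<lambda>(f, a). f \<le> a) (zip fs w))"

definition nonexceeding :: "nat list \<Rightarrow> nat list \<Rightarrow> nat list" where
  "nonexceeding fs w = map snd (filter (\<lambda>(f, a). \<not> f \<le> a) (zip fs w))"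

fun fill :: "cell list \<Rightarrow> nat list \<Rightarrow> nat list" where
  "fill [] z = []"
| "fill (Exc a # u) z = a # fill u z"
| "fill (_ # u) z = hd z # fill u (tl z)"

lemma fillable_Nil: "fillable [] [] z"
  by (simp add: fillable_def gap_bounds_def)

lemma fillable_Gap_Cons:
  "fillable (Gap # u) (f # fs) z \<longleftrightarrow> z \<noteq> [] \<and> hd z < f \<and> fillable u fs (tl z)"
  by (cases z) (auto simp: fillable_def gap_bounds_def All_less_Suc2)

lemma fillable_Exc_Cons: "fillable (Exc a # u) (f # fs) z \<longleftrightarrow> f \<le> a \<and> fillable u fs z"
  by (auto simp: fillable_def gap_bounds_def)

lemma length_mark [simp]: "length fs = length w \<Longrightarrow> length (mark fs w) = length w"
  by (simp add: mark_def)

lemma fill_mark: "length fs = length w \<Longrightarrow> fill (mark fs w) (nonexceeding fs w) = w"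
  by (induction fs w rule: list_induct2) (auto simp: mark_def nonexceeding_def)

lemma fillable_mark: "length fs = length w \<Longrightarrow> fillable (mark fs w) fs (nonexceeding fs w)"
  by (induction fs w rule: list_induct2)
    (auto simp: mark_def nonexceeding_def fillable_Nil fillable_Gap_Cons fillable_Exc_Cons)

lemma count_Hole_mark: "length fs = length w \<Longrightarrow> count (mset (mark fs w)) Hole = 0"
  by (induction fs w rule: list_induct2) (auto simp: mark_def)

lemma cell_letters_mark: "length fs = length w \<Longrightarrow> cell_letters (mark fs w) = mset (exceeding fs w)"
  by (induction fs w rule: list_induct2) (auto simp: mark_def exceeding_def)

lemma mset_exceeding_nonexceeding:
  "length fs = length w \<Longrightarrow> mset (exceeding fs w) + mset (nonexceeding fs w) = mset w"
  by (induction fs w rule: list_induct2) (auto simp: exceeding_def nonexceeding_def)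

text \<open>
  Fillability says exactly that the gaps of \<open>u\<close> are the places at which the filled word stays
  below the threshold. So \<open>fill\<close> and marking are inverse to each other.
\<close>

lemma mark_fill:
  assumes "length u = length fs" and "count (mset u) Hole = 0" and "fillable u fs z"
    and "length z = count (mset u) Gap"
  shows "mark fs (fill u z) = u" and "nonexceeding fs (fill u z) = z"
    and "mset (fill u z) = cell_letters u + mset z"
proof -
  have "mark fs (fill u z) = u \<and> nonexceeding fs (fill u z) = z \<and> mset (fill u z) = cell_letters u + mset z"
    using assms
  proof (induction u fs arbitrary: z rule: list_induct2)
    case (Cons c u f fs)
    show ?case
    proof (cases c)
      case Gap
      then obtain b z' where z: "z = b # z'"
        using Cons.prems by (cases z) auto
      show ?thesis
        using Cons.IH[of z'] Cons.prems
        by (auto simp: Gap z mark_def nonexceeding_def fillable_Gap_Cons)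
    next
      case (Exc a)
      then show ?thesis
        using Cons.IH[of z] Cons.prems
        by (auto simp: mark_def nonexceeding_def fillable_Exc_Cons)
    qed (use Cons.prems in auto)
  qed (auto simp: mark_def nonexceeding_def)
  then show "mark fs (fill u z) = u" and "nonexceeding fs (fill u z) = z"
    and "mset (fill u z) = cell_letters u + mset z"
    by auto
qed

lemma hole_gf_eq_sum_words:
  assumes "size M = length fs"
  shows "hole_gf L B q fs M 0 t = (\<Sum>w\<in>permutations_of_multiset M.
    cell_weight L B q t (mark fs w) * q ^ inv_count (nonexceeding fs w))"
proof -
  let ?U = "cell_lists (length fs) 0 M"
  let ?Z = "\<lambda>u. {z \<in> permutations_of_multiset (M - cell_letters u). fillable u fs z}"
  have "hole_gf L B q fs M 0 t = (\<Sum>u\<in>?U. \<Sum>z\<in>?Z u. cell_weight L B q t u * q ^ inv_count z)"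
    unfolding hole_gf_def fill_gf_def
    by (simp only: sum.inter_filter finite_permutations_of_multiset flip: sum_distrib_left)
  also have "\<dots> = (\<Sum>(u, z)\<in>Sigma ?U ?Z. cell_weight L B q t u * q ^ inv_count z)"
    by (subst sum.Sigma) auto
  also have "\<dots> = (\<Sum>w\<in>permutations_of_multiset M.
    cell_weight L B q t (mark fs w) * q ^ inv_count (nonexceeding fs w))"
  proof (rule sum.reindex_bij_witness[where
        i = "\<lambda>w. (mark fs w, nonexceeding fs w)" and j = "\<lambda>(u, z). fill u z"])
    fix w assume "w \<in> permutations_of_multiset M"
    then have w: "mset w = M" "length fs = length w"
      using assms by (auto simp: permutations_of_multiset_def)
    note sum = mset_exceeding_nonexceeding[OF w(2), unfolded w(1)]
    then have sub: "cell_letters (mark fs w) \<subseteq># M"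
      and diff: "M - cell_letters (mark fs w) = mset (nonexceeding fs w)"
      by (auto simp: cell_letters_mark[OF w(2)] simp flip: sum)
    show "(case (mark fs w, nonexceeding fs w) of (u, z) \<Rightarrow> fill u z) = w"
      using w by (simp add: fill_mark)
    show "(mark fs w, nonexceeding fs w) \<in> Sigma ?U ?Z"
      using w sub diff count_Hole_mark[OF w(2)]
      by (simp add: cell_lists_def fillable_mark permutations_of_multiset_def)
  next
    fix p assume "p \<in> Sigma ?U ?Z"
    then obtain u z where p: "p = (u, z)" and u: "length u = length fs" "count (mset u) Hole = 0"
      "cell_letters u \<subseteq># M" and z: "mset z = M - cell_letters u" "fillable u fs z"
      by (auto simp: cell_lists_def permutations_of_multiset_def)
    have "length z = size M - size (cell_letters u)"
      using u z by (metis size_Diff_submset size_mset)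
    then have "length z = count (mset u) Gap"
      using length_cells[of u] u assms by simp
    note fill = mark_fill[OF u(1,2) z(2) this]
    show "(case p of (u, z) \<Rightarrow> fill u z) \<in> permutations_of_multiset M"
      using fill(3) u z by (simp add: p permutations_of_multiset_def)
    show "(mark fs (case p of (u, z) \<Rightarrow> fill u z), nonexceeding fs (case p of (u, z) \<Rightarrow> fill u z)) = p"
      by (simp add: p fill)
    show "cell_weight L B q t (mark fs (case p of (u, z) \<Rightarrow> fill u z))
        * q ^ inv_count (nonexceeding fs (case p of (u, z) \<Rightarrow> fill u z))
      = (case p of (u, z) \<Rightarrow> cell_weight L B q t u * q ^ inv_count z)"
      by (simp add: p fill)
  qed
  finally show ?thesis .
qed

lemma nths_exceeding:
  "length fs = length w \<Longrightarrow> nths w {i. i < length w \<and> fs ! i \<le> w ! i} = exceeding fs w"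
  by (induction fs w rule: list_induct2) (auto simp: exceeding_def nths_Cons)

lemma nths_nonexceeding:
  "length fs = length w \<Longrightarrow> nths w {i. \<not> (i < length w \<and> fs ! i \<le> w ! i)} = nonexceeding fs w"
  by (induction fs w rule: list_induct2) (auto simp: nonexceeding_def nths_Cons)

lemma sum_exceeding:
  fixes b :: "nat \<Rightarrow> nat"
  assumes "length fs = length w"
  shows "(\<Sum>i | i < length w \<and> fs ! i \<le> w ! i. b (w ! i)) = (\<Sum>a\<in>#mset (exceeding fs w). b a)"
proof -
  have "(\<Sum>i<length w. if fs ! i \<le> w ! i then b (w ! i) else 0) = (\<Sum>a\<in>#mset (exceeding fs w). b a)"
    using assms
    by (induction fs w rule: list_induct2)
      (auto simp: exceeding_def sum.lessThan_Suc_shift simp del: sum.lessThan_Suc cong: if_cong)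
  moreover have "{i. i < length w \<and> fs ! i \<le> w ! i} = {i \<in> {..<length w}. fs ! i \<le> w ! i}"
    by auto
  ultimately show ?thesis
    by (simp only: sum.inter_filter finite_lessThan)
qed

lemma cell_imv_mark:
  "length fs = length w \<Longrightarrow> cell_imv (mark fs w) = pair_count (\<lambda>x y. y \<le> x) (exceeding fs w)"
proof (induction fs w rule: list_induct2)
  case (Cons f fs a w)
  have mark: "mark (f # fs) (a # w) = (if f \<le> a then Exc a else Gap) # mark fs w"
    by (simp add: mark_def)
  have exceeding: "exceeding (f # fs) (a # w) = (if f \<le> a then [a] else []) @ exceeding fs w"
    by (simp add: exceeding_def)
  have "filter_mset (dominates (Exc a)) (cell_letters (mark fs w)) = mset (filter (\<lambda>b. b \<le> a) (exceeding fs w))"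
    using Cons.hyps by (simp add: cell_letters_mark cong: filter_mset_cong)
  then have "size (filter_mset (dominates (Exc a)) (cell_letters (mark fs w)))
      = length (filter (\<lambda>b. b \<le> a) (exceeding fs w))"
    by (simp only: size_mset)
  moreover have "filter_mset (dominates Gap) N = {#}" for N
    by (induction N) auto
  ultimately show ?case
    using Cons.IH by (simp add: mark exceeding)
qed (simp add: mark_def exceeding_def)

lemma cell_weight_mark:
  assumes len: "length fs = length w"
  defines "E \<equiv> {i. i < length w \<and> fs ! i \<le> w ! i}"
  shows "cell_weight L B q t (mark fs w) = t ^ card {i \<in> E. L \<le> i}
    * q ^ ((\<Sum>i\<in>E. Suc i + B (w ! i)) + pair_count (\<lambda>x y. y \<le> x) (exceeding fs w))"
proof -
  have E: "E = {i \<in> {..<length w}. fs ! i \<le> w ! i}"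
    by (auto simp: E_def)
  have fin: "finite E"
    by (simp add: E)
  have "(\<Prod>i<length (mark fs w). if mark fs w ! i = Gap then 1 else (if L \<le> i then t else 1) * q ^ Suc i)
      = (\<Prod>i<length w. if fs ! i \<le> w ! i then (if L \<le> i then t else 1) * q ^ Suc i else 1)"
    using len by (intro prod.cong) (auto simp: mark_def)
  also have "\<dots> = (\<Prod>i\<in>E. (if L \<le> i then t else 1) * q ^ Suc i)"
    unfolding E by (rule prod.inter_filter[symmetric]) simp
  also have "\<dots> = (\<Prod>i\<in>E. if L \<le> i then t else 1) * q ^ (\<Sum>i\<in>E. Suc i)"
    by (simp only: prod.distrib power_sum)
  also have "(\<Prod>i\<in>E. if L \<le> i then t else 1) = t ^ card {i \<in> E. L \<le> i}"
    using fin by (simp flip: prod.inter_filter)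
  finally show ?thesis
    using sum_exceeding[OF len, of B] len
    by (simp only: cell_weight_def cell_imv_mark[OF len] cell_letters_mark[OF len] E_def
        sum.distrib power_add mult_ac)
qed

context gap_data
begin

text \<open>
  With the thresholds \<open>max h (x + g)\<close> the excedance places of level \<open>h\<close> are the non-gaps. The
  excedances counted by \<open>gap_exc\<close> are those among them that lie beyond the first \<open>low\<close> places,
  because \<open>x \<ge> l\<close> and \<open>a \<ge> x + g\<close> imply \<open>a \<ge> g + l \<ge> h\<close>.
\<close>

lemma den_weight_eq_cell_weight:
  assumes w: "mset w = mset xs"
  shows "t ^ gap_exc g l w * q ^ gap_den g h w
    = cell_weight low between q t (mark thresholds w) * q ^ inv_count (nonexceeding thresholds w)"
proof -
  let ?E = "{i. i < length w \<and> thresholds ! i \<le> w ! i}"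
  have sort: "sort w = xs"
    using w sorted_xs by (metis mset_sort properties_for_sort sorted_sort)
  have len: "length xs = length w"
    using w by (metis size_mset)
  then have tlen: "length thresholds = length w"
    by simp
  have thr: "thresholds ! i \<le> w ! i \<longleftrightarrow> h \<le> w ! i \<and> xs ! i + g \<le> w ! i" if "i < length w" for i
    using that len by (simp add: thresholds_def)
  have Excp: "gap_Excp g h w = Suc ` ?E"
  proof (intro set_eqI iffI)
    fix i assume "i \<in> gap_Excp g h w"
    then show "i \<in> Suc ` ?E"
      by (cases i) (auto simp: gap_Excp_def sort letter_def thr)
  qed (auto simp: gap_Excp_def sort letter_def thr)
  have "{i \<in> {1..length w}. letter w i \<ge> letter (sort w) i + g \<and> letter (sort w) i \<ge> l}
      = Suc ` {i \<in> ?E. low \<le> i}"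
  proof (intro set_eqI iffI)
    fix i assume "i \<in> {i \<in> {1..length w}. letter w i \<ge> letter (sort w) i + g \<and> letter (sort w) i \<ge> l}"
    then show "i \<in> Suc ` {i \<in> ?E. low \<le> i}"
      using less_low_iff[of "i - 1"] h_le len
      by (cases i) (auto simp: sort letter_def thr)
  next
    fix i assume "i \<in> Suc ` {i \<in> ?E. low \<le> i}"
    then show "i \<in> {i \<in> {1..length w}. letter w i \<ge> letter (sort w) i + g \<and> letter (sort w) i \<ge> l}"
      using less_low_iff[of "i - 1"] len
      by (auto simp: sort letter_def thr)
  qed
  then have exc: "gap_exc g l w = card {i \<in> ?E. low \<le> i}"
    by (simp add: gap_exc_def card_image)
  have B: "gap_B g w i = between (letter w i)" for i
    using card_positions_letter[of xs "\<lambda>y. letter w i < y + g \<and> y < letter w i"]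
    by (simp add: gap_B_def sort between_def len)
  have Exc: "gap_Exc g h w = exceeding thresholds w"
    using nths_exceeding[OF tlen] by (simp add: gap_Exc_def Excp image_iff)
  have Nexc: "gap_Nexc g h w = nonexceeding thresholds w"
    using nths_nonexceeding[OF tlen] by (simp add: gap_Nexc_def Excp image_iff)
  have inv: "inv_num z = inv_count z" and imv: "imv_num z = pair_count (\<lambda>x y. y \<le> x) z" for z
    using card_pairs_eq_pair_count[of z "\<lambda>x y. y < x"] card_pairs_eq_pair_count[of z "\<lambda>x y. y \<le> x"]
    by (simp_all add: inv_num_def imv_num_def)
  have "(\<Sum>i\<in>gap_Excp g h w. i + gap_B g w i) = (\<Sum>i\<in>?E. Suc i + between (w ! i))"
    unfolding Excp by (subst sum.reindex) (auto simp: B letter_def intro!: sum.cong)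
  then have "gap_den g h w = (\<Sum>i\<in>?E. Suc i + between (w ! i))
      + pair_count (\<lambda>x y. y \<le> x) (exceeding thresholds w) + inv_count (nonexceeding thresholds w)"
    by (simp add: gap_den_def Exc Nexc inv imv)
  then show ?thesis
    using cell_weight_mark[OF tlen, of low between q t] by (simp add: exc power_add mult_ac)
qed

theorem sum_des_maj_eq_sum_exc_den:
  "(\<Sum>w\<in>permutations_of_multiset (mset xs). t ^ gap_des g l w * q ^ gap_maj g l w)
    = (\<Sum>w\<in>permutations_of_multiset (mset xs). t ^ gap_exc g l w * q ^ gap_den g h w)"
proof -
  have "(\<Sum>w\<in>permutations_of_multiset (mset xs). t ^ gap_exc g l w * q ^ gap_den g h w)
      = hole_gf low between q thresholds (mset xs) 0 t"
    by (subst hole_gf_eq_sum_words)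
      (auto simp: permutations_of_multiset_def den_weight_eq_cell_weight intro!: sum.cong)
  then show ?thesis
    by (simp add: hole_gf_eq_maj_gf maj_gf_def maj_weight_def)
qed

end

section \<open>The generating functions in two indeterminates\<close>

lemma var_q_power_neq_1:
  assumes "0 < k"
  shows "var_q ^ k \<noteq> 1"
proof
  assume "var_q ^ k = 1"
  then have "poly (poly (var_q ^ k) 0) 2 = poly (poly 1 0) 2"
    by simp
  then show False
    using assms by (simp add: var_q_def poly_power)
qed

theorem theorem1p7:
  fixes n g l h :: nat and k :: "nat \<Rightarrow> nat"
  assumes "\<And>i. i \<in> {1..n} \<Longrightarrow> k i \<ge> 1"
    and "g \<ge> 1" and "l \<ge> 1"
    and "1 \<le> h" and "h \<le> g + l"
  shows "(\<Sum>w\<in>permutations_of_multiset (word_mset n k). var_t ^ gap_des g l w * var_q ^ gap_maj g l w)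
       = (\<Sum>w\<in>permutations_of_multiset (word_mset n k). var_t ^ gap_exc g l w * var_q ^ gap_den g h w)"
proof -
  let ?xs = "sorted_list_of_multiset (word_mset n k)"
  interpret gap_data g l h ?xs var_q
    using assms var_q_power_neq_1 by unfold_locales auto
  show ?thesis
    using sum_des_maj_eq_sum_exc_den[of var_t] by simp
qed

end
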